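(* For the generalized aztec diamond lattice, the entropy constant $\eta=\lim_{m,n\to\infty} f(m,n)^{1/(2mn+m+n)}$ exists and satisfies $$1.503041110\le \eta\le 1.503048372 .$$
   Context: For positive integers $m,n$ the generalized aztec diamond of order $m\times n$ is the graph with vertices $(x,y)$, $1\le x\le 2m+1$, $1\le y\le 2n+1$, $x+y$ odd, where $(x,y)$ is adjacent to $(x',y')$ iff $|x-x'|=|y-y'|=1$. It has $2mn+m+n$ vertices. $f(m,n)$ is its number of independent sets (the empty set included), and the limit is the double limit with $m,n\to\infty$ independently. *)

theory Defs
  imports "HOL-Analysis.Analysis"
begin

definition independent_sets :: "'v set \<Rightarrow> ('v \<Rightarrow> 'v \<Rightarrow> bool) \<Rightarrow> 'v set set" where
  "independent_sets V adj = {S. S \<subseteq> V \<and> (\<forall>u\<in>S. \<forall>v\<in>S. \<not> adj u v)}"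

definition aztec_vertices :: "nat \<Rightarrow> nat \<Rightarrow> (int \<times> int) set" where
  "aztec_vertices m n =
     {(x, y). 1 \<le> x \<and> x \<le> 2 * int m + 1 \<and> 1 \<le> y \<and> y \<le> 2 * int n + 1 \<and> odd (x + y)}"

definition aztec_adj :: "int \<times> int \<Rightarrow> int \<times> int \<Rightarrow> bool" where
  "aztec_adj = (\<lambda>(x, y) (x', y'). \<bar>x - x'\<bar> = 1 \<and> \<bar>y - y'\<bar> = 1)"

definition aztec_count :: "nat \<Rightarrow> nat \<Rightarrow> nat" where
  "aztec_count m n = card (independent_sets (aztec_vertices m n) aztec_adj)"

lemma finite_aztec_vertices: "finite (aztec_vertices m n)"
  by (rule finite_subset[of _ "{1..2 * int m + 1} \<times> {1..2 * int n + 1}"])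
     (auto simp: aztec_vertices_def)

lemma finite_independent_sets: "finite V \<Longrightarrow> finite (independent_sets V adj)"
  by (rule finite_subset[of _ "Pow V"]) (auto simp: independent_sets_def)

lemma card_aztec_vertices: "card (aztec_vertices m n) = 2 * m * n + m + n"
proof -
  let ?f = "\<lambda>(i, j). (2 * i + 1, 2 * j) :: int \<times> int"
  let ?g = "\<lambda>(i, j). (2 * i, 2 * j + 1) :: int \<times> int"
  let ?A = "{0..int m} \<times> {1..int n}" and ?B = "{1..int m} \<times> {0..int n}"
  have "aztec_vertices m n = ?f ` ?A \<union> ?g ` ?B"
  proof (intro equalityI subsetI)
    fix p assume "p \<in> aztec_vertices m n"
    then obtain x y where p: "p = (x, y)" and
      b: "1 \<le> x" "x \<le> 2 * int m + 1" "1 \<le> y" "y \<le> 2 * int n + 1" and o: "odd (x + y)"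
      by (auto simp: aztec_vertices_def)
    show "p \<in> ?f ` ?A \<union> ?g ` ?B"
    proof (cases "odd x")
      case True
      with o obtain i j where "x = 2 * i + 1" "y = 2 * j" by (auto elim!: oddE evenE)
      with p b have "p = ?f (i, j)" "(i, j) \<in> ?A" by auto
      then show ?thesis by blast
    next
      case False
      with o have "even x" "odd y" by auto
      then obtain i j where "x = 2 * i" "y = 2 * j + 1" by (metis evenE oddE)
      with p b have "p = ?g (i, j)" "(i, j) \<in> ?B" by auto
      then show ?thesis by blast
    qed
  qed (auto simp: aztec_vertices_def)
  moreover have "?f ` ?A \<inter> ?g ` ?B = {}" by (auto, presburger)
  moreover have "card (?f ` ?A) = (m + 1) * n" "card (?g ` ?B) = m * (n + 1)"
    by (subst card_image; auto simp: inj_on_def card_cartesian_product nat_add_distrib)+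
  ultimately show ?thesis
    by (simp add: card_Un_disjoint)
qed

end

theory Submission
  imports Defs "HOL-Real_Asymp.Real_Asymp"
begin

text \<open>
  Let \<open>f m n\<close> be the number of independent sets. Leaving a row (or column) empty shows that \<open>ln f\<close> is
  superadditive in each argument, so that \<open>ln (f m n) / ((m + 1) * (n + 1))\<close> tends to its supremum \<open>L\<close>,
  and \<open>\<eta> = exp (L / 2)\<close>.

  Lower bound: write \<open>f m n\<close> as a sum over the middle row. By reflection symmetry and
  Cauchy--Schwarz it is log-convex in \<open>n\<close>, and it remains so when the sites of the two boundary rows get
  activity \<open>1/2\<close> (weight 2 if empty and 1 if occupied). Hence \<open>exp L\<close> is at least the quotient of the
  growth rates, as \<open>m \<rightarrow> \<infinity>\<close>, of the weighted strips for \<open>n = 5\<close> and \<open>n = 4\<close>.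

  Upper bound: the tenth power of the two-row transfer matrix is bounded by its trace, which counts
  the independent sets of a cylinder with 20 rows. Hence \<open>exp (10 * L)\<close> is at most the growth rate of
  that cylinder per two columns.

  The growth rates are bounded in the manner of Collatz and Wielandt: a positive vector \<open>X\<close> with
  \<open>T X \<le> \<lambda> X\<close> (or \<open>\<ge>\<close>) entrywise bounds the growth of the powers of a nonnegative matrix \<open>T\<close>.
\<close>

section \<open>Transfer vectors of layered graphs\<close>

text \<open>The row transfer matrices have about \<open>2 ^ m\<close> states and are never
  evaluated; they serve only for Cauchy--Schwarz. Columns of a strip or cylinder of fixed height
  have boundedly many states, so every quantity is defined by rows and computed by columns, and all
  tables have depth 4, 5 or 10. The normalisation by \<open>(m + 1) * (n + 1)\<close> counts a
  diamond together with one separating row and column, which makes superadditivity exact. There are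
  about twice as many vertices, hence the factor 1/2 in \<open>exp (L / 2)\<close>. Two limits have
  to be kept apart. Since \<open>L\<close> is a supremum,
  \<open>f m n \<le> exp (L * (m + 1) * (n + 1))\<close> holds for all \<open>m\<close> and
  \<open>n\<close>. The lower bound on the entropy uses this for fixed \<open>m\<close> with growing
  \<open>n\<close>, and only then lets \<open>m\<close> grow; boundary weights depending on
  \<open>m\<close> are therefore harmless. The upper bound uses the double limit along a single
  path. Exponents: raising \<open>n\<close> by one adds two rows and contributes \<eta>^2 per unit
  of \<open>m\<close>, so the strip quotient is compared with the square of 1.503041110. The
  cylinder has ten sites per column, so one column is compared with \<eta>^10 and two columns with
  \<eta>^20.\<close>

primrec transfer_vec ::
  "(nat \<Rightarrow> 'q set) \<Rightarrow> (nat \<Rightarrow> 'q \<Rightarrow> 'q \<Rightarrow> bool) \<Rightarrow> (nat \<Rightarrow> 'q \<Rightarrow> real) \<Rightarrow> nat \<Rightarrow> 'q \<Rightarrow> real" where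
  "transfer_vec Q K w 0 q = w 0 q"
| "transfer_vec Q K w (Suc k) q =
     w (Suc k) q * (\<Sum>p | p \<in> Q k \<and> K k p q. transfer_vec Q K w k p)"

text \<open>One transfer argument serves three instances: the rows of the diamond, its columns, and
  the columns of the cylinder. \<open>emb\<close> and \<open>state\<close> identify abstract states
  with the subsets of a layer, so that rows can stay sets while columns become bit lists fit for
  computation.\<close>

locale layered_graph =
  fixes adj :: "'v \<Rightarrow> 'v \<Rightarrow> bool" and L :: "nat \<Rightarrow> 'v set" and Q :: "nat \<Rightarrow> 'q set"
    and emb :: "nat \<Rightarrow> 'q \<Rightarrow> 'v set" and state :: "nat \<Rightarrow> 'v set \<Rightarrow> 'q"
    and K :: "nat \<Rightarrow> 'q \<Rightarrow> 'q \<Rightarrow> bool"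
  assumes finite_layer: "finite (L k)"
    and disjoint_layers: "i \<noteq> j \<Longrightarrow> L i \<inter> L j = {}"
    and adj_layers: "u \<in> L i \<Longrightarrow> v \<in> L j \<Longrightarrow> adj u v \<Longrightarrow> i = Suc j \<or> j = Suc i"
    and emb_subset: "q \<in> Q k \<Longrightarrow> emb k q \<subseteq> L k"
    and state_in: "state k S \<in> Q k"
    and emb_state: "emb k (state k S) = S \<inter> L k"
    and state_emb: "q \<in> Q k \<Longrightarrow> state k (emb k q) = q"
    and K_iff: "p \<in> Q k \<Longrightarrow> q \<in> Q (Suc k) \<Longrightarrow>
      K k p q \<longleftrightarrow> (\<forall>u\<in>emb k p. \<forall>v\<in>emb (Suc k) q. \<not> adj u v \<and> \<not> adj v u)"
begin

definition upto :: "nat \<Rightarrow> 'v set" where "upto k = (\<Union>j\<le>k. L j)"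

lemma state_eqI: "S \<inter> L k = S' \<inter> L k \<Longrightarrow> state k S = state k S'"
  using state_emb[OF state_in, of k S] state_emb[OF state_in, of k S'] by (simp add: emb_state)

lemma state_eq_iff: "q \<in> Q k \<Longrightarrow> state k S = q \<longleftrightarrow> S \<inter> L k = emb k q"
  by (metis emb_state inf.absorb_iff2 inf_commute emb_subset state_emb state_eqI)

lemma finite_Q: "finite (Q k)"
proof (rule inj_on_finite[of "emb k" _ "Pow (L k)"])
  show "inj_on (emb k) (Q k)" by (metis inj_onI state_emb)
qed (use emb_subset finite_layer in auto)

lemma finite_upto: "finite (upto k)"
  by (simp add: upto_def finite_layer)

lemma finite_ind: "finite (independent_sets (upto k) adj)"
  by (rule finite_independent_sets[OF finite_upto])

lemma upto_Suc: "upto (Suc k) = upto k \<union> L (Suc k)"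
  by (auto simp: upto_def atMost_Suc)

lemma upto_disjoint: "upto k \<inter> L (Suc k) = {}"
  proof -
  have "L j \<inter> L (Suc k) = {}" if "j \<le> k" for j
    using disjoint_layers[of j "Suc k"] that by simp
  then show ?thesis by (auto simp: upto_def)
qed

text \<open>Edges join consecutive layers only, so whether a new layer may be added depends on the
  last state alone. Deleting the top layer is the inverse map.\<close>

lemma bij_extend:
  assumes q: "q \<in> Q (Suc k)"
  shows "bij_betw (\<lambda>S. S \<union> emb (Suc k) q)
    {S \<in> independent_sets (upto k) adj. K k (state k S) q}
    {S \<in> independent_sets (upto (Suc k)) adj. state (Suc k) S = q}"
proof (rule bij_betw_byWitness[where f' = "\<lambda>S. S \<inter> upto k"])
  let ?A = "{S \<in> independent_sets (upto k) adj. K k (state k S) q}"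
  let ?B = "{S \<in> independent_sets (upto (Suc k)) adj. state (Suc k) S = q}"
  let ?e = "emb (Suc k) q"
  have e: "?e \<subseteq> L (Suc k)" using emb_subset[OF q] .
  show "\<forall>S\<in>?A. (S \<union> ?e) \<inter> upto k = S"
    using e upto_disjoint[of k] by (auto simp: independent_sets_def)
  show "\<forall>S\<in>?B. S \<inter> upto k \<union> ?e = S"
    using state_eq_iff[OF q] by (auto simp: independent_sets_def upto_Suc)
  show "(\<lambda>S. S \<inter> upto k) ` ?B \<subseteq> ?A"
  proof clarify
    fix S assume S: "S \<in> independent_sets (upto (Suc k)) adj" and sq: "q = state (Suc k) S"
    have Lk: "L k \<subseteq> upto k" by (auto simp: upto_def)
    have "state k (S \<inter> upto k) = state k S" by (rule state_eqI) (use Lk in auto)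
    moreover have "K k (state k S) q"
      unfolding K_iff[OF state_in q] using S unfolding sq emb_state independent_sets_def by auto
    ultimately show "S \<inter> upto k \<in> independent_sets (upto k) adj \<and> K k (state k (S \<inter> upto k)) (state (Suc k) S)"
      using S sq by (auto simp: independent_sets_def)
  qed
  show "(\<lambda>S. S \<union> ?e) ` ?A \<subseteq> ?B"
  proof clarify
    fix S assume S: "S \<in> independent_sets (upto k) adj" and K: "K k (state k S) q"
    have "state (Suc k) (S \<union> ?e) = q"
      unfolding state_eq_iff[OF q] using S e upto_disjoint[of k]
      by (auto simp: independent_sets_def)
    moreover have "\<not> adj u v \<and> \<not> adj v u" if u: "u \<in> S" and v: "v \<in> ?e" for u v
    proof -
      obtain j where j: "j \<le> k" "u \<in> L j"
        using S u by (auto simp: independent_sets_def upto_def)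
      have v': "v \<in> L (Suc k)" using v e by auto
      show ?thesis
      proof (cases "j = k")
        case True
        then have "u \<in> emb k (state k S)" using u j by (simp add: emb_state)
        then show ?thesis using K v unfolding K_iff[OF state_in q] by blast
      next
        case False
        then show ?thesis using adj_layers[OF j(2) v'] adj_layers[OF v' j(2)] j by auto
      qed
    qed
    moreover have "\<not> adj u v" if "u \<in> ?e" "v \<in> ?e" for u v
      using adj_layers[of u "Suc k" v "Suc k"] that e by auto
    ultimately show "S \<union> ?e \<in> independent_sets (upto (Suc k)) adj \<and> state (Suc k) (S \<union> ?e) = q"
      using S e by (auto simp: independent_sets_def upto_Suc)
  qed
qed

text \<open>The weight is a product over layers: \<open>bij_extend\<close> splits off the factor of
  the new layer, and grouping the remaining sets by their last state gives the recursion.\<close>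

lemma sum_fibre_eq_transfer_vec:
  "q \<in> Q k \<Longrightarrow>
   (\<Sum>S | S \<in> independent_sets (upto k) adj \<and> state k S = q. \<Prod>j\<le>k. w j (state j S))
     = transfer_vec Q K w k q"
proof (induction k arbitrary: q)
  case 0
  have "{S \<in> independent_sets (upto 0) adj. state 0 S = q} = {emb 0 q}"
    using emb_subset[OF 0] adj_layers[of _ 0 _ 0] state_emb[OF 0] state_eq_iff[OF 0]
    by (auto simp: independent_sets_def upto_def)
  then show ?case using state_emb[OF 0] by simp
next
  case (Suc k)
  let ?I = "\<lambda>k. independent_sets (upto k) adj"
  let ?W = "\<lambda>k S. \<Prod>j\<le>k. w j (state j S)"
  have st: "state j (S \<union> emb (Suc k) q) = state j S" if "j \<le> k" for j S
    using disjoint_layers[of j "Suc k"] emb_subset[OF Suc.prems] that by (intro state_eqI) auto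
  have stS: "state (Suc k) (S \<union> emb (Suc k) q) = q" if "S \<in> ?I k" for S
    unfolding state_eq_iff[OF Suc.prems] using that emb_subset[OF Suc.prems] upto_disjoint[of k]
    by (auto simp: independent_sets_def)
  have "(\<Sum>S | S \<in> ?I (Suc k) \<and> state (Suc k) S = q. ?W (Suc k) S)
      = (\<Sum>S | S \<in> ?I k \<and> K k (state k S) q. ?W (Suc k) (S \<union> emb (Suc k) q))"
    by (rule sum.reindex_bij_betw[OF bij_extend[OF Suc.prems], symmetric])
  also have "\<dots> = (\<Sum>S | S \<in> ?I k \<and> K k (state k S) q. w (Suc k) q * ?W k S)"
    by (rule sum.cong) (auto simp: atMost_Suc st stS)
  also have "\<dots> = w (Suc k) q * (\<Sum>S | S \<in> ?I k \<and> K k (state k S) q. ?W k S)"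
    by (simp add: sum_distrib_left)
  also have "(\<Sum>S | S \<in> ?I k \<and> K k (state k S) q. ?W k S)
      = (\<Sum>p | p \<in> Q k \<and> K k p q. \<Sum>S | S \<in> {S \<in> ?I k. K k (state k S) q} \<and> state k S = p. ?W k S)"
    by (rule sum.group[symmetric]) (auto simp: finite_ind finite_Q state_in)
  also have "\<dots> = (\<Sum>p | p \<in> Q k \<and> K k p q. transfer_vec Q K w k p)"
  proof (rule sum.cong[OF refl])
    fix p assume p: "p \<in> {p \<in> Q k. K k p q}"
    then have "{S \<in> {S \<in> ?I k. K k (state k S) q}. state k S = p} = {S \<in> ?I k. state k S = p}" by auto
    then show "(\<Sum>S | S \<in> {S \<in> ?I k. K k (state k S) q} \<and> state k S = p. ?W k S) = transfer_vec Q K w k p"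
      using Suc.IH[of p] p by simp
  qed
  finally show ?case by simp
qed

lemma sum_independent_sets:
  "(\<Sum>S\<in>independent_sets (upto k) adj. g (state k S) * (\<Prod>j\<le>k. w j (state j S)))
     = (\<Sum>q\<in>Q k. g q * transfer_vec Q K w k q)"
proof -
  let ?I = "independent_sets (upto k) adj"
  let ?W = "\<lambda>S. \<Prod>j\<le>k. w j (state j S)"
  have "(\<Sum>S\<in>?I. g (state k S) * ?W S)
      = (\<Sum>q\<in>Q k. \<Sum>S | S \<in> ?I \<and> state k S = q. g (state k S) * ?W S)"
    by (rule sum.group[symmetric]) (auto simp: finite_ind finite_Q state_in)
  also have "\<dots> = (\<Sum>q\<in>Q k. g q * (\<Sum>S | S \<in> ?I \<and> state k S = q. ?W S))"
    by (intro sum.cong refl) (auto simp: sum_distrib_left)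
  finally show ?thesis by (simp add: sum_fibre_eq_transfer_vec)
qed

end

section \<open>Rows of the diamond\<close>

definition row_sites :: "nat \<Rightarrow> nat \<Rightarrow> int set" where
  "row_sites m k = {x. 1 \<le> x \<and> x \<le> 2 * int m + 1 \<and> (even x \<longleftrightarrow> even k)}"

definition nonadjacent :: "int set \<Rightarrow> int set \<Rightarrow> bool" where
  "nonadjacent p q \<longleftrightarrow> (\<forall>x\<in>p. \<forall>y\<in>q. \<bar>x - y\<bar> \<noteq> 1)"

definition row_state :: "nat \<Rightarrow> nat \<Rightarrow> (int \<times> int) set \<Rightarrow> int set" where
  "row_state m k S = {x \<in> row_sites m k. (x, int k + 1) \<in> S}"

lemma finite_row_sites: "finite (row_sites m k)"
  by (rule finite_subset[of _ "{1..2 * int m + 1}"]) (auto simp: row_sites_def)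

lemma row_sites_parity: "even j = even k \<Longrightarrow> row_sites m j = row_sites m k"
  by (simp add: row_sites_def)

interpretation rows: layered_graph aztec_adj "\<lambda>k. (\<lambda>x. (x, int k + 1)) ` row_sites m k"
  "\<lambda>k. Pow (row_sites m k)" "\<lambda>k q. (\<lambda>x. (x, int k + 1)) ` q" "row_state m" "\<lambda>_. nonadjacent" for m
  by unfold_locales (auto simp: finite_row_sites aztec_adj_def row_state_def nonadjacent_def
      abs_minus_commute)

lemma rows_upto: "rows.upto m (2 * n) = aztec_vertices m n"
proof (intro equalityI subsetI)
  fix v assume "v \<in> rows.upto m (2 * n)"
  then show "v \<in> aztec_vertices m n"
    unfolding rows.upto_def by (auto simp: row_sites_def aztec_vertices_def)
next
  fix v assume v: "v \<in> aztec_vertices m n"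
  obtain x y where xy: "v = (x, y)" by force
  have "nat (y - 1) \<le> 2 * n" "x \<in> row_sites m (nat (y - 1))" "y = int (nat (y - 1)) + 1"
    using v by (auto simp: xy aztec_vertices_def row_sites_def even_nat_iff)
  then show "v \<in> rows.upto m (2 * n)" unfolding rows.upto_def xy by blast
qed

text \<open>The initial vector is a parameter so that the vector reached after an even number of
  rows can serve as a new start (\<open>row_vec_add\<close>).\<close>

primrec row_vec :: "nat \<Rightarrow> (int set \<Rightarrow> real) \<Rightarrow> nat \<Rightarrow> int set \<Rightarrow> real" where
  "row_vec m b 0 q = b q"
| "row_vec m b (Suc k) q = (\<Sum>p | p \<in> Pow (row_sites m k) \<and> nonadjacent p q. row_vec m b k p)"

lemma row_vec_eq_transfer_vec:
  "row_vec m b k q = transfer_vec (\<lambda>k. Pow (row_sites m k)) (\<lambda>_. nonadjacent) (\<lambda>j q. if j = 0 then b q else 1) k q"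
  by (induction k arbitrary: q) simp_all

lemma row_vec_fibre:
  assumes "q \<in> Pow (row_sites m (2 * n))"
  shows "row_vec m b (2 * n) q
    = (\<Sum>S | S \<in> independent_sets (aztec_vertices m n) aztec_adj \<and> row_state m (2 * n) S = q.
         b (row_state m 0 S))"
proof -
  have "(\<Prod>j\<le>k. if j = 0 then b (row_state m j S) else 1) = b (row_state m 0 S)" for k S
    by (simp add: prod.delta)
  then show ?thesis
    using rows.sum_fibre_eq_transfer_vec[OF assms, where w = "\<lambda>j q. if j = 0 then b q else 1"]
    by (simp add: row_vec_eq_transfer_vec rows_upto)
qed

section \<open>Inner products of row vectors and log-convexity\<close>

text \<open>This is the quadratic form of \<open>b\<close> under the \<open>n\<close>-th power of
  the two-row transfer matrix. That matrix is a one-row matrix times its transpose, hence symmetric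
  and positive semidefinite.\<close>

definition boundary_sum :: "nat \<Rightarrow> (int set \<Rightarrow> real) \<Rightarrow> nat \<Rightarrow> real" where
  "boundary_sum m b n = (\<Sum>S\<in>independent_sets (aztec_vertices m n) aztec_adj.
     b (row_state m (2 * n) S) * b (row_state m 0 S))"

lemma boundary_sum_one: "boundary_sum m (\<lambda>_. 1) n = real (aztec_count m n)"
  by (simp add: boundary_sum_def aztec_count_def)

lemma boundary_sum_eq: "boundary_sum m b n = (\<Sum>q\<in>Pow (row_sites m 0). b q * row_vec m b (2 * n) q)"
proof -
  have "(\<Prod>j\<le>k. if j = 0 then b (row_state m j S) else 1) = b (row_state m 0 S)" for k S
    by (simp add: prod.delta)
  moreover have "row_sites m (2 * n) = row_sites m 0" by (rule row_sites_parity) simp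
  ultimately show ?thesis
    using rows.sum_independent_sets[where m = m and k = "2 * n" and g = b and w = "\<lambda>j q. if j = 0 then b q else 1"]
    by (simp add: row_vec_eq_transfer_vec rows_upto boundary_sum_def)
qed

definition row_inner :: "nat \<Rightarrow> nat \<Rightarrow> (int set \<Rightarrow> real) \<Rightarrow> (int set \<Rightarrow> real) \<Rightarrow> real" where
  "row_inner m k u v = (\<Sum>q\<in>Pow (row_sites m k). u q * v q)"

text \<open>Nonadjacency is symmetric, so a row step is adjoint to the step back and can be moved to
  the other factor. The parity condition makes rows \<open>c\<close> and \<open>Suc a\<close> have
  the same sites.\<close>

lemma row_inner_shift:
  assumes "even a \<longleftrightarrow> odd c"
  shows "row_inner m (Suc a) (row_vec m b (Suc a)) (row_vec m b c)
       = row_inner m a (row_vec m b a) (row_vec m b (Suc c))"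
proof -
  have c: "row_sites m c = row_sites m (Suc a)" using assms by (intro row_sites_parity) auto
  let ?P = "\<lambda>k. Pow (row_sites m k)"
  let ?f = "\<lambda>p q. if nonadjacent p q then row_vec m b a p * row_vec m b c q else 0"
  have comm: "nonadjacent p q \<longleftrightarrow> nonadjacent q p" for p q
    unfolding nonadjacent_def by (metis abs_minus_commute)
  have fin: "finite (?P k)" for k by (simp add: finite_row_sites)
  have "row_inner m (Suc a) (row_vec m b (Suc a)) (row_vec m b c) = (\<Sum>q\<in>?P (Suc a). \<Sum>p\<in>?P a. ?f p q)"
    unfolding row_inner_def
    by (simp add: sum_distrib_right sum.inter_filter[symmetric] fin if_distrib cong: if_cong)
       (simp add: sum.inter_filter[OF fin, symmetric] sum_distrib_right)
  also have "\<dots> = (\<Sum>p\<in>?P a. \<Sum>q\<in>?P (Suc a). ?f p q)" by (rule sum.swap)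
  also have "\<dots> = row_inner m a (row_vec m b a) (row_vec m b (Suc c))"
    unfolding row_inner_def row_vec.simps c
    by (simp add: sum.inter_filter[OF fin, symmetric] sum_distrib_left comm[of _ "_ :: int set"])
  finally show ?thesis .
qed

text \<open>The place of the cut is immaterial: moving one row at a time across the inner product
  ends at \<open>a = 0\<close>, where the first factor is \<open>b\<close> itself.\<close>

lemma row_inner_eq_boundary_sum:
  "even (a + c) \<Longrightarrow> row_inner m a (row_vec m b a) (row_vec m b c) = boundary_sum m b ((a + c) div 2)"
proof (induction a arbitrary: c)
  case 0
  then show ?case by (simp add: row_inner_def boundary_sum_eq)
next
  case (Suc a)
  then have "row_inner m (Suc a) (row_vec m b (Suc a)) (row_vec m b c)
    = row_inner m a (row_vec m b a) (row_vec m b (Suc c))" by (intro row_inner_shift) auto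
  also have "\<dots> = boundary_sum m b ((a + Suc c) div 2)" using Suc.prems by (intro Suc.IH) simp
  finally show ?case by (simp del: row_vec.simps)
qed

text \<open>Cutting at the middle row turns the count into an inner product, so Cauchy--Schwarz gives
  log-convexity in the number of rows.\<close>

lemma boundary_sum_log_convex:
  "(boundary_sum m b (Suc n))\<^sup>2 \<le> boundary_sum m b n * boundary_sum m b (Suc (Suc n))"
proof -
  let ?v = "row_vec m b"
  \<comment> \<open>The three sums have \<open>2 * n\<close>, \<open>2 * n + 2\<close> and
    \<open>2 * n + 4\<close> row steps. They are split as \<open>n\<close> and \<open>n + 2\<close>,
    twice \<open>n\<close>, and twice \<open>n + 2\<close>; rows \<open>n\<close> and
    \<open>n + 2\<close> have the same sites, so all vectors lie in one space.\<close>
  have "boundary_sum m b (Suc n) = row_inner m n (?v n) (?v (n + 2))"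
    by (subst row_inner_eq_boundary_sum) auto
  moreover have "boundary_sum m b n = row_inner m n (?v n) (?v n)"
    by (subst row_inner_eq_boundary_sum) auto
  moreover have "boundary_sum m b (Suc (Suc n)) = row_inner m (n + 2) (?v (n + 2)) (?v (n + 2))"
    by (subst row_inner_eq_boundary_sum) auto
  moreover have "row_inner m (n + 2) (?v (n + 2)) (?v (n + 2)) = row_inner m n (?v (n + 2)) (?v (n + 2))"
    unfolding row_inner_def by (subst row_sites_parity[of "n + 2" n]) auto
  ultimately show ?thesis
    using Cauchy_Schwarz_ineq_sum[of "?v n" "?v (n + 2)" "Pow (row_sites m n)"]
    by (simp add: row_inner_def power2_eq_square)
qed

lemma row_vec_ge_1:
  assumes "\<And>q. 1 \<le> b q"
  shows "1 \<le> row_vec m b k q"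
proof (induction k arbitrary: q)
  case (Suc k)
  have "row_vec m b k {} \<le> row_vec m b (Suc k) q"
    unfolding row_vec.simps
    by (rule member_le_sum) (use Suc in \<open>auto simp: nonadjacent_def finite_row_sites intro: order_trans[OF zero_le_one]\<close>)
  then show ?case using Suc[of "{}"] by linarith
qed (simp add: assms)

lemma boundary_sum_pos:
  assumes "\<And>q. 1 \<le> b q"
  shows "0 < boundary_sum m b n"
  unfolding boundary_sum_eq
proof (rule sum_pos)
  fix q
  show "0 < b q * row_vec m b (2 * n) q"
    using assms[of q] row_vec_ge_1[of b m "2 * n" q, OF assms] by (intro mult_pos_pos) linarith+
qed (auto simp: finite_row_sites)

lemma aztec_count_ge_1: "1 \<le> real (aztec_count m n)"
  using boundary_sum_pos[of "\<lambda>_. 1" m n] by (simp add: boundary_sum_one Suc_le_eq)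

text \<open>Log-convexity says that quotients of consecutive terms never decrease, so the quotient
  at \<open>n\<close> bounds all later ones from below.\<close>

lemma log_convex_growth:
  fixes a :: "nat \<Rightarrow> real"
  assumes pos: "\<And>k. 0 < a k" and conv: "\<And>k. (a (Suc k))\<^sup>2 \<le> a k * a (Suc (Suc k))"
  shows "a n * (a (Suc n) / a n) ^ k \<le> a (n + k)"
proof -
  define r where "r = a (Suc n) / a n"
  have r: "0 < r" by (simp add: r_def pos)
  have step: "r * a (n + k) \<le> a (Suc (n + k))" for k
  proof (induction k)
    case 0
    show ?case using pos[of n] by (simp add: r_def)
  next
    case (Suc k)
    have "r * a (n + k) * a (Suc (n + k)) \<le> a (Suc (n + k)) * a (Suc (n + k))"
      using Suc pos[of "Suc (n + k)"] by (intro mult_right_mono) auto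
    also have "\<dots> \<le> a (n + k) * a (Suc (Suc (n + k)))"
      using conv[of "n + k"] by (simp add: power2_eq_square)
    finally show ?case using pos[of "n + k"] by (simp add: mult_ac)
  qed
  have "a n * r ^ k \<le> a (n + k)"
  proof (induction k)
    case (Suc k)
    have "a n * r ^ Suc k = r * (a n * r ^ k)" by simp
    also have "\<dots> \<le> r * a (n + k)" using Suc r by (intro mult_left_mono) auto
    also have "\<dots> \<le> a (n + Suc k)" using step[of k] by simp
    finally show ?case .
  qed simp
  then show ?thesis by (simp add: r_def)
qed

section \<open>Supermultiplicativity and elementary bounds of the counts\<close>

text \<open>The rows add up because
  \<open>(2 * n1 + 1) + 1 + (2 * n2 + 1) = 2 * (n1 + n2 + 1) + 1\<close>, the middle summand being
  the empty separating row.\<close>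

lemma aztec_count_supermult:
  "real (aztec_count m n1) * real (aztec_count m n2) \<le> real (aztec_count m (n1 + n2 + 1))"
proof -
  let ?v = "row_vec m (\<lambda>_. 1)" and ?f = "real (aztec_count m n1)"
  have sites: "row_sites m (2 * n1 + 2 + k) = row_sites m k" for k by (rule row_sites_parity) auto
  have "row_sites m (2 * n1) = row_sites m 0" by (rule row_sites_parity) auto
  \<comment> \<open>The empty row is compatible with every state of the row before it, so its entry
    sums over all independent sets of the first diamond.\<close>
  then have f: "?v (Suc (2 * n1)) {} = ?f"
    by (simp add: boundary_sum_one[symmetric] boundary_sum_eq nonadjacent_def Pow_def)
  \<comment> \<open>Row \<open>2 * n1 + 2 + k\<close> plays the part of row \<open>k\<close> of the
    second diamond. At \<open>k = 0\<close> the entry is bounded below by the contribution of the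
    empty row alone.\<close>
  have le: "?f * ?v k q \<le> ?v (2 * n1 + 2 + k) q" for k q
  proof (induction k arbitrary: q)
    case 0
    have "?v (Suc (2 * n1)) {} \<le> ?v (Suc (Suc (2 * n1))) q"
      unfolding row_vec.simps(2)[of m _ "Suc (2 * n1)"]
      by (rule member_le_sum)
         (auto simp: nonadjacent_def finite_row_sites simp del: row_vec.simps
            intro!: order_trans[OF zero_le_one row_vec_ge_1])
    then show ?case using f by simp
  next
    case (Suc k)
    then show ?case using sites[of k] by (simp add: sum_distrib_left sum_mono)
  qed
  have "?f * real (aztec_count m n2) = (\<Sum>q\<in>Pow (row_sites m 0). ?f * ?v (2 * n2) q)"
    by (simp add: boundary_sum_one[symmetric, of m n2] boundary_sum_eq sum_distrib_left)
  also have "\<dots> \<le> (\<Sum>q\<in>Pow (row_sites m 0). ?v (2 * n1 + 2 + 2 * n2) q)"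
    by (intro sum_mono le)
  also have "\<dots> = real (aztec_count m (n1 + n2 + 1))"
    by (simp add: boundary_sum_one[symmetric] boundary_sum_eq algebra_simps)
  finally show ?thesis .
qed

lemma aztec_count_commute: "aztec_count m n = aztec_count n m"
proof -
  have sub: "(\<lambda>S. prod.swap ` S) ` independent_sets (aztec_vertices m n) aztec_adj
      \<subseteq> independent_sets (aztec_vertices n m) aztec_adj" for m n
    by (force simp: independent_sets_def aztec_vertices_def aztec_adj_def add.commute)
  have "bij_betw (\<lambda>S. prod.swap ` S) (independent_sets (aztec_vertices m n) aztec_adj)
      (independent_sets (aztec_vertices n m) aztec_adj)"
    by (rule bij_betw_byWitness[where f' = "\<lambda>S. prod.swap ` S"]) (auto simp: image_comp sub)
  then show ?thesis unfolding aztec_count_def by (rule bij_betw_same_card)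
qed

lemma aztec_count_upper: "real (aztec_count m n) \<le> 2 ^ (2 * m * n + m + n)"
proof -
  have "aztec_count m n \<le> card (Pow (aztec_vertices m n))"
    unfolding aztec_count_def
    by (rule card_mono) (auto simp: finite_aztec_vertices independent_sets_def)
  then have "aztec_count m n \<le> 2 ^ (2 * m * n + m + n)"
    by (simp add: card_Pow finite_aztec_vertices card_aztec_vertices)
  then show ?thesis by (metis of_nat_le_iff of_nat_numeral of_nat_power)
qed

section \<open>The entropy limit\<close>

text \<open>In the variable \<open>n + 1\<close> the hypothesis is ordinary superadditivity, and
  \<open>q\<close> blocks of length \<open>N + 1\<close> fit into \<open>n + 1\<close>. When
  \<open>n = N\<close> no remainder is left to which the induction hypothesis could apply, so this
  case is separate.\<close>

lemma superadditive_multiple: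
  fixes f :: "nat \<Rightarrow> real"
  assumes nonneg: "\<And>n. 0 \<le> f n" and super: "\<And>i j. f i + f j \<le> f (i + j + 1)"
    and "q * (N + 1) \<le> n + 1"
  shows "real q * f N \<le> f n"
  using assms(3)
proof (induction q arbitrary: n)
  case (Suc q)
  show ?case
  proof (cases "n = N")
    case True
    have "q * (N + 1) = 0" using Suc.prems True by (auto simp: algebra_simps)
    then have "q = 0" by simp
    then show ?thesis using True by simp
  next
    case False
    define k where "k = n - N - 1"
    have n: "n = k + N + 1" using Suc.prems False by (simp add: k_def)
    have "real q * f N \<le> f k" using Suc.prems n by (intro Suc.IH) (simp add: algebra_simps)
    then show ?thesis using super[of k N] n by (simp add: algebra_simps)
  qed
qed (simp add: nonneg)

lemma tendsto_real_Suc_ratio: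
  "((\<lambda>n. 1 - (real N + 1) / (real n + 1)) \<longlongrightarrow> 1) sequentially"
  by real_asymp

text \<open>Fekete's argument in two variables, with \<open>L\<close> the supremum of the normalised
  values. A large rectangle is tiled by a fixed one of nearly optimal value. Rounding the numbers of
  tiles down costs only the two factors in \<open>lower\<close>; these tend to 1 as both sides grow,
  which yields the limit along the product filter directly.\<close>

lemma superadditive_2d_limit:
  fixes a :: "nat \<Rightarrow> nat \<Rightarrow> real"
  assumes nonneg: "\<And>m n. 0 \<le> a m n"
    and super1: "\<And>i j n. a i n + a j n \<le> a (i + j + 1) n"
    and super2: "\<And>m i j. a m i + a m j \<le> a m (i + j + 1)"
    and bound: "\<And>m n. a m n \<le> C * ((real m + 1) * (real n + 1))"
  obtains L where "\<And>m n. a m n \<le> L * ((real m + 1) * (real n + 1))"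
    and "((\<lambda>(m, n). a m n / ((real m + 1) * (real n + 1))) \<longlongrightarrow> L) (sequentially \<times>\<^sub>F sequentially)"
proof -
  define h where "h m n = a m n / ((real m + 1) * (real n + 1))" for m n
  define L where "L = (SUP p. h (fst p) (snd p))"
  have pos: "0 < (real m + 1) * (real n + 1)" for m n by (intro mult_pos_pos) auto
  have "h m n \<le> C" for m n unfolding h_def using bound[of m n] pos[of m n] by (simp add: pos_divide_le_eq)
  then have bdd: "bdd_above (range (\<lambda>p. h (fst p) (snd p)))" by (intro bdd_aboveI2[of _ _ C])
  have le: "h m n \<le> L" for m n unfolding L_def using cSUP_upper[OF _ bdd, of "(m, n)"] by simp
  have quot: "q * (N + 1) \<le> n + 1 \<and> (real n + 1) / (real N + 1) - 1 \<le> real q"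
    if "q = (n + 1) div (N + 1)" for q n N :: nat
  proof
    show "q * (N + 1) \<le> n + 1" unfolding that by (rule div_times_less_eq_dividend)
    have "n + 1 < (N + 1) * Suc q"
      unfolding that by (metis dividend_less_times_div mult_Suc_right add.commute zero_less_Suc Suc_eq_plus1)
    then have "real n + 1 < (real N + 1) * (real q + 1)"
      by (metis of_nat_less_iff of_nat_mult of_nat_Suc Suc_eq_plus1 add.commute)
    then show "(real n + 1) / (real N + 1) - 1 \<le> real q" by (simp add: field_simps)
  qed
  have lower: "h M N * ((1 - (real M + 1) / (real m + 1)) * (1 - (real N + 1) / (real n + 1))) \<le> h m n"
    if m: "M \<le> m" and n: "N \<le> n" for m n M N
  proof -
    define q r where "q = (m + 1) div (M + 1)" and "r = (n + 1) div (N + 1)"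
    let ?x = "(real m + 1) / (real M + 1) - 1" and ?y = "(real n + 1) / (real N + 1) - 1"
    have x: "0 \<le> ?x" "?x \<le> real q" and y: "0 \<le> ?y" "?y \<le> real r"
      using m n quot[OF q_def] quot[OF r_def] by (auto simp: field_simps)
    have "?x * ?y * a M N \<le> real q * real r * a M N"
      using x y by (intro mult_right_mono mult_mono nonneg) auto
    also have "\<dots> = real q * (real r * a M N)" by simp
    also have "\<dots> \<le> real q * a M n"
      using quot[OF r_def] by (intro mult_left_mono superadditive_multiple nonneg super2) auto
    also have "\<dots> \<le> a m n"
      using quot[OF q_def] by (intro superadditive_multiple[of "\<lambda>m. a m n"] nonneg super1) auto
    finally have "?x * ?y * a M N / ((real m + 1) * (real n + 1)) \<le> h m n"
      unfolding h_def using pos[of m n] by (intro divide_right_mono) auto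
    moreover have "?x * ?y * a M N / ((real m + 1) * (real n + 1))
        = h M N * ((1 - (real M + 1) / (real m + 1)) * (1 - (real N + 1) / (real n + 1)))"
      unfolding h_def by (simp add: divide_simps)
    ultimately show ?thesis by simp
  qed
  have lim: "((\<lambda>(m, n). h m n) \<longlongrightarrow> L) (sequentially \<times>\<^sub>F sequentially)"
  proof (rule order_tendstoI)
    fix l assume "l < L"
    then obtain M N where MN: "l < h M N"
      unfolding L_def using less_cSUP_iff[OF _ bdd] by auto
    let ?F = "sequentially \<times>\<^sub>F sequentially"
    have "((\<lambda>p. h M N * ((1 - (real M + 1) / (real (fst p) + 1)) * (1 - (real N + 1) / (real (snd p) + 1))))
        \<longlongrightarrow> h M N * (1 * 1)) ?F"
      by (intro tendsto_intros filterlim_compose[OF tendsto_real_Suc_ratio filterlim_fst]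
          filterlim_compose[OF tendsto_real_Suc_ratio filterlim_snd])
    then have "\<forall>\<^sub>F p in ?F. l < h M N * ((1 - (real M + 1) / (real (fst p) + 1)) * (1 - (real N + 1) / (real (snd p) + 1)))"
      by (rule order_tendstoD) (use MN in simp)
    moreover have "\<forall>\<^sub>F p in ?F. M \<le> fst p"
      by (rule eventually_compose_filterlim[OF eventually_ge_at_top filterlim_fst])
    moreover have "\<forall>\<^sub>F p in ?F. N \<le> snd p"
      by (rule eventually_compose_filterlim[OF eventually_ge_at_top filterlim_snd])
    ultimately show "\<forall>\<^sub>F p in ?F. l < (case p of (m, n) \<Rightarrow> h m n)"
      by eventually_elim (use lower in \<open>force simp: case_prod_beta intro: less_le_trans\<close>)
  next
    fix u assume "L < u"
    then have "h m n < u" for m n using le[of m n] by linarith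
    then show "\<forall>\<^sub>F p in sequentially \<times>\<^sub>F sequentially. (case p of (m, n) \<Rightarrow> h m n) < u"
      by (simp add: case_prod_beta)
  qed
  show thesis
  proof (rule that[of L])
    show "a m n \<le> L * ((real m + 1) * (real n + 1))" for m n
      using le[of m n] pos[of m n] unfolding h_def by (simp add: pos_divide_le_eq)
  qed (use lim in \<open>simp add: h_def\<close>)
qed

text \<open>The constants are swamped by the powers. This is applied once to growth in
  \<open>n\<close> for fixed \<open>m\<close>, and once to growth in \<open>m\<close>.\<close>

lemma geometric_base_le:
  fixes c C x y :: real
  assumes "0 < c" "0 < y" and le: "\<And>k::nat. c * x ^ k \<le> C * y ^ k"
  shows "x \<le> y"
proof (rule ccontr)
  assume "\<not> x \<le> y"
  then have "1 < x / y" using assms(2) by simp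
  then obtain k where k: "C / c < (x / y) ^ k" using real_arch_pow by blast
  then have "C < c * (x / y) ^ k" using assms(1) by (simp add: pos_divide_less_eq mult.commute)
  then have "C * y ^ k < c * x ^ k" using assms(2) by (simp add: power_divide pos_less_divide_eq)
  then show False using le[of k] by simp
qed

text \<open>The inequality is stated beside the limit because the lower bound on the entropy needs
  it at every finite \<open>m\<close> and \<open>n\<close>.\<close>

lemma aztec_entropy:
  obtains L where "\<And>m n. real (aztec_count m n) \<le> exp (L * ((real m + 1) * (real n + 1)))"
    and "((\<lambda>(m, n). ln (real (aztec_count m n)) / ((real m + 1) * (real n + 1))) \<longlongrightarrow> L)
          (sequentially \<times>\<^sub>F sequentially)"
proof -
  let ?a = "\<lambda>m n. ln (real (aztec_count m n))"
  have pos: "0 < real (aztec_count m n)" for m n using aztec_count_ge_1[of m n] by linarith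
  have super2: "?a m i + ?a m j \<le> ?a m (i + j + 1)" for m i j
    using aztec_count_supermult[of m i j] by (simp only: ln_mult_pos[OF pos pos, symmetric] ln_le_cancel_iff mult_pos_pos pos)
  have super1: "?a i n + ?a j n \<le> ?a (i + j + 1) n" for i j n
    using super2[of n i j] by (simp only: aztec_count_commute[of _ n])
  have bound: "?a m n \<le> (2 * ln 2) * ((real m + 1) * (real n + 1))" for m n
  proof -
    have "?a m n \<le> ln (2 ^ (2 * m * n + m + n))"
      using aztec_count_upper[of m n] pos[of m n] by (subst ln_le_cancel_iff) auto
    also have "\<dots> = real (2 * m * n + m + n) * ln 2" by (simp add: ln_realpow)
    also have "\<dots> \<le> (2 * ((real m + 1) * (real n + 1))) * ln 2"
      by (intro mult_right_mono) (auto simp: algebra_simps)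
    finally show ?thesis by (simp add: mult_ac)
  qed
  show thesis
  proof (rule superadditive_2d_limit[of ?a, OF _ super1 super2 bound])
    show "0 \<le> ?a m n" for m n using aztec_count_ge_1[of m n] by simp
    fix L
    assume L: "\<And>m n. ?a m n \<le> L * ((real m + 1) * (real n + 1))"
      and lim: "((\<lambda>(m, n). ?a m n / ((real m + 1) * (real n + 1))) \<longlongrightarrow> L) (sequentially \<times>\<^sub>F sequentially)"
    show thesis
    proof (rule that[OF _ lim])
      show "real (aztec_count m n) \<le> exp (L * ((real m + 1) * (real n + 1)))" for m n
        using L[of m n] pos[of m n] by (metis exp_le_cancel_iff exp_ln)
    qed
  qed
qed

text \<open>The number of vertices divided by \<open>(m + 1) * (n + 1)\<close> is exactly
  \<open>2 - 1 / (m + 1) - 1 / (n + 1)\<close>, which tends to 2.\<close>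

lemma aztec_root_limit:
  assumes lim: "((\<lambda>(m, n). ln (real (aztec_count m n)) / ((real m + 1) * (real n + 1))) \<longlongrightarrow> L)
          (sequentially \<times>\<^sub>F sequentially)"
  shows "((\<lambda>(m, n). real (aztec_count m n) powr (1 / real (2 * m * n + m + n))) \<longlongrightarrow> exp (L / 2))
      (sequentially \<times>\<^sub>F sequentially)"
proof -
  let ?F = "sequentially \<times>\<^sub>F sequentially"
  have "((\<lambda>n. 1 / (real n + 1)) \<longlongrightarrow> 0) sequentially" by real_asymp
  note inv = filterlim_compose[OF this filterlim_fst] filterlim_compose[OF this filterlim_snd]
  have "((\<lambda>p. exp ((case p of (m, n) \<Rightarrow> ln (real (aztec_count m n)) / ((real m + 1) * (real n + 1)))
      / (2 - 1 / (real (fst p) + 1) - 1 / (real (snd p) + 1)))) \<longlongrightarrow> exp (L / (2 - 0 - 0))) ?F"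
    by (intro tendsto_intros lim inv) simp
  moreover have "exp (ln (real (aztec_count m n)) / ((real m + 1) * (real n + 1))
      / (2 - 1 / (real m + 1) - 1 / (real n + 1)))
      = real (aztec_count m n) powr (1 / real (2 * m * n + m + n))" for m n
  proof -
    have "(real m + 1) * (real n + 1) * (2 - 1 / (real m + 1) - 1 / (real n + 1)) = real (2 * m * n + m + n)"
      by (simp add: divide_simps) (simp add: algebra_simps)
    moreover have "aztec_count m n \<noteq> 0" using aztec_count_ge_1[of m n] by auto
    ultimately show ?thesis by (simp add: powr_def divide_divide_eq_left)
  qed
  ultimately show ?thesis by (simp add: case_prod_unfold)
qed

section \<open>Comparing the entropy with growth rates\<close>

text \<open>Log-convexity makes every quotient of consecutive boundary sums a lower bound for the growth
  of the boundary sums, which for fixed \<open>m\<close> is at most that of the counts.\<close>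

lemma boundary_sum_ratio_le:
  assumes L: "\<And>m n. real (aztec_count m n) \<le> exp (L * ((real m + 1) * (real n + 1)))"
    and b: "\<And>q. 1 \<le> b q" "\<And>q. b q \<le> B"
  shows "boundary_sum m b (Suc n) \<le> boundary_sum m b n * exp (L * (real m + 1))"
proof -
  let ?F = "boundary_sum m b"
  have pos: "0 < ?F k" for k by (rule boundary_sum_pos[OF b(1)])
  \<comment> \<open>Replacing the weights by \<open>B\<close> costs a factor that does not depend on
    \<open>k\<close>. It may depend on \<open>m\<close>, since only the growth in \<open>k\<close>
    is compared here.\<close>
  have B: "?F k \<le> B\<^sup>2 * real (aztec_count m k)" for k
  proof -
    have "?F k \<le> (\<Sum>S\<in>independent_sets (aztec_vertices m k) aztec_adj. B\<^sup>2)"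
      unfolding boundary_sum_def
    proof (rule sum_mono)
      fix S
      have "0 \<le> b q" "0 \<le> B" for q using b(1)[of q] b(2)[of q] by linarith+
      then show "b (row_state m (2 * k) S) * b (row_state m 0 S) \<le> B\<^sup>2"
        unfolding power2_eq_square by (intro mult_mono b) auto
    qed
    then show ?thesis by (simp add: aztec_count_def mult.commute)
  qed
  have "?F (Suc n) / ?F n \<le> exp (L * (real m + 1))"
  proof (rule geometric_base_le[of "?F n" _ _ "B\<^sup>2 * exp (L * (real m + 1) * (real n + 1))"])
    fix k
    have "?F n * (?F (Suc n) / ?F n) ^ k \<le> ?F (n + k)"
      by (rule log_convex_growth) (use pos boundary_sum_log_convex in auto)
    also have "\<dots> \<le> B\<^sup>2 * exp (L * ((real m + 1) * (real (n + k) + 1)))"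
      using B[of "n + k"] L[of m "n + k"] by (meson mult_left_mono order_trans zero_le_power2)
    also have "\<dots> = B\<^sup>2 * exp (L * (real m + 1) * (real n + 1)) * exp (L * (real m + 1)) ^ k"
      by (simp add: exp_of_nat_mult[symmetric] mult_exp_exp algebra_simps)
    finally show "?F n * (?F (Suc n) / ?F n) ^ k
        \<le> B\<^sup>2 * exp (L * (real m + 1) * (real n + 1)) * exp (L * (real m + 1)) ^ k" .
  qed (use pos in auto)
  then show ?thesis using pos[of n] by (simp add: pos_divide_le_eq mult.commute)
qed

text \<open>For each \<open>m\<close> the quotient of the two boundary sums is at most
  \<open>exp (L * (m + 1))\<close>. No uniformity of \<open>B m\<close> is required, because
  \<open>B m\<close> has already disappeared when the growth in \<open>m\<close> is
  compared.\<close>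

lemma entropy_lower_bound:
  assumes L: "\<And>m n. real (aztec_count m n) \<le> exp (L * ((real m + 1) * (real n + 1)))"
    and b: "\<And>m q. 1 \<le> b m q" "\<And>m q. b m q \<le> B m"
    and lo: "0 < c" "\<And>m. c * x ^ m \<le> boundary_sum m (b m) (Suc n)"
    and up: "0 < y" "\<And>m. boundary_sum m (b m) n \<le> C * y ^ m"
  shows "x \<le> y * exp L"
proof (rule geometric_base_le[of c _ _ "C * exp L"])
  fix m
  have "c * x ^ m \<le> boundary_sum m (b m) n * exp (L * (real m + 1))"
    by (rule order_trans[OF lo(2) boundary_sum_ratio_le[OF L b]])
  also have "\<dots> \<le> C * y ^ m * exp (L * (real m + 1))" using up(2) by (intro mult_right_mono) auto
  also have "\<dots> = C * exp L * (y * exp L) ^ m"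
    by (simp add: exp_of_nat_mult[symmetric] mult_exp_exp algebra_simps power_mult_distrib)
  finally show "c * x ^ m \<le> C * exp L * (y * exp L) ^ m" .
qed (use lo(1) up(1) in auto)

text \<open>The limit is taken along the path \<open>(k, p * k)\<close>. There the logarithms of
  \<open>2 ^ k\<close> and \<open>C ^ k\<close> are of order \<open>k\<close>, against a
  normalisation of order \<open>p * k ^ 2\<close>, so only \<open>ln y / p\<close> survives.\<close>

lemma entropy_upper_bound:
  assumes lim: "((\<lambda>(m, n). ln (real (aztec_count m n)) / ((real m + 1) * (real n + 1))) \<longlongrightarrow> L)
          (sequentially \<times>\<^sub>F sequentially)"
    and step: "\<And>m k. real (aztec_count m (p * Suc k)) \<le> Z m * real (aztec_count m (p * k))"
    and Z: "\<And>m. 0 \<le> Z m" "\<And>m. Z m \<le> C * y ^ m" and pos: "0 < p" "0 < C" "0 < y"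
  shows "exp (L * real p) \<le> y"
proof -
  have it: "real (aztec_count m (p * k)) \<le> 2 ^ m * (C * y ^ m) ^ k" for m k
  proof (induction k)
    case 0
    show ?case using aztec_count_upper[of m 0] by simp
  next
    case (Suc k)
    have "real (aztec_count m (p * Suc k)) \<le> Z m * (2 ^ m * (C * y ^ m) ^ k)"
      using step[of m k] Suc Z(1) by (meson mult_left_mono order_trans)
    also have "\<dots> \<le> C * y ^ m * (2 ^ m * (C * y ^ m) ^ k)"
      using Z(2) pos by (intro mult_right_mono) auto
    finally show ?case by (simp add: mult_ac)
  qed
  have ln_it: "ln (real (aztec_count k (p * k))) \<le> real k * ln 2 + real k * (ln C + real k * ln y)" for k
  proof -
    have "ln (real (aztec_count k (p * k))) \<le> ln (2 ^ k * (C * y ^ k) ^ k)"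
      using it[of k k] aztec_count_ge_1[of k "p * k"] pos by (subst ln_le_cancel_iff) auto
    then show ?thesis using pos by (simp add: ln_mult_pos ln_realpow)
  qed
  have "filterlim (\<lambda>k. p * k) sequentially sequentially"
    using pos(1) by (rule mult_nat_left_at_top)
  then have "filterlim (\<lambda>k. (k, p * k)) (sequentially \<times>\<^sub>F sequentially) sequentially"
    by (intro filterlim_Pair filterlim_ident)
  from filterlim_compose[OF lim this]
  have seq: "(\<lambda>k. ln (real (aztec_count k (p * k))) / ((real k + 1) * (real (p * k) + 1))) \<longlonglongrightarrow> L"
    by simp
  have bnd: "(\<lambda>k. (real k * ln 2 + real k * (ln C + real k * ln y)) / ((real k + 1) * (real p * real k + 1)))
      \<longlonglongrightarrow> ln y / real p"
    using pos(1) unfolding divide_inverse[of "ln y"] by real_asymp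
  have "L \<le> ln y / real p"
  proof (rule LIMSEQ_le[OF seq bnd], intro exI allI impI)
    fix k :: nat
    show "ln (real (aztec_count k (p * k))) / ((real k + 1) * (real (p * k) + 1))
        \<le> (real k * ln 2 + real k * (ln C + real k * ln y)) / ((real k + 1) * (real p * real k + 1))"
      using ln_it[of k] by (simp add: divide_right_mono)
  qed
  then have "L * real p \<le> ln y" using pos(1) by (simp add: pos_le_divide_eq)
  then show ?thesis using pos(3) by (metis exp_le_cancel_iff exp_ln)
qed

section \<open>Bit lists and tables\<close>

definition bitlists :: "nat \<Rightarrow> bool list set" where
  "bitlists n = {bs. length bs = n}"

lemma finite_bitlists: "finite (bitlists n)"
  using finite_lists_length_eq[of "UNIV :: bool set" n] by (simp add: bitlists_def)

lemma bitlists_0: "bitlists 0 = {[]}"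
  by (auto simp: bitlists_def)

lemma sum_bitlists_Suc:
  "(\<Sum>s\<in>bitlists (Suc n). g s) = (\<Sum>s\<in>bitlists n. g (False # s)) + (\<Sum>s\<in>bitlists n. g (True # s))"
proof -
  have eq: "bitlists (Suc n) = (#) False ` bitlists n \<union> (#) True ` bitlists n"
  proof (intro equalityI subsetI)
    fix s assume "s \<in> bitlists (Suc n)"
    then obtain b t where "s = b # t" "length t = n" by (auto simp: bitlists_def length_Suc_conv)
    then show "s \<in> (#) False ` bitlists n \<union> (#) True ` bitlists n"
      by (cases b) (auto simp: bitlists_def)
  qed (auto simp: bitlists_def)
  show ?thesis
    unfolding eq by (subst sum.union_disjoint) (auto simp: finite_bitlists sum.reindex inj_on_def)
qed

text \<open>Neighbouring columns of the diamond have \<open>n\<close> and \<open>n + 1\<close>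
  sites, and site \<open>i\<close> of the shorter one touches sites \<open>i\<close> and
  \<open>i + 1\<close> of the longer one.\<close>

fun zigzag :: "bool list \<Rightarrow> bool list \<Rightarrow> bool" where
  "zigzag [] [t] = True"
| "zigzag (s # ss) (t # t' # ts) = ((s \<longrightarrow> \<not> t \<and> \<not> t') \<and> zigzag ss (t' # ts))"
| "zigzag _ _ = False"

lemma zigzag_iff:
  "zigzag s t \<longleftrightarrow> length t = Suc (length s) \<and> (\<forall>i<length s. s ! i \<longrightarrow> \<not> t ! i \<and> \<not> t ! Suc i)"
  by (induction s t rule: zigzag.induct) (auto simp: less_Suc_eq_0_disj)

datatype bit_tree = Lf int | Nd bit_tree bit_tree

text \<open>A set bit selects the right subtree. The values for ill-shaped arguments, here and in
  \<open>add\<close>, are arbitrary and are excluded by \<open>full\<close>.\<close>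

fun val :: "bit_tree \<Rightarrow> bool list \<Rightarrow> int" where
  "val (Lf x) _ = x"
| "val (Nd A B) (b # bs) = val (if b then B else A) bs"
| "val (Nd A B) [] = 0"

fun full :: "nat \<Rightarrow> bit_tree \<Rightarrow> bool" where
  "full 0 (Lf x) = True"
| "full (Suc n) (Nd A B) = (full n A \<and> full n B)"
| "full _ _ = False"

lemma full_Suc_iff: "full (Suc n) T \<longleftrightarrow> (\<exists>A B. T = Nd A B \<and> full n A \<and> full n B)"
  by (cases T) auto

lemma full_0_iff: "full 0 T \<longleftrightarrow> (\<exists>x. T = Lf x)"
  by (cases T) auto

fun add :: "bit_tree \<Rightarrow> bit_tree \<Rightarrow> bit_tree" where
  "add (Lf a) (Lf b) = Lf (a + b)"
| "add (Nd A B) (Nd C D) = Nd (add A C) (add B D)"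
| "add _ _ = Lf 0"

lemma size_add: "size (add A B) \<le> size A"
  by (induction A B rule: add.induct) auto

text \<open>For the termination of the functions below that recurse into the sum of two
  subtrees.\<close>

lemma size_add_less [termination_simp]: "size A < k \<Longrightarrow> size (add A B) < k"
  using size_add[of A B] by simp

lemma full_add: "full n A \<Longrightarrow> full n B \<Longrightarrow> full n (add A B)"
  by (induction n arbitrary: A B) (auto simp: full_Suc_iff full_0_iff)

lemma val_add: "full n A \<Longrightarrow> full n B \<Longrightarrow> length bs = n \<Longrightarrow> val (add A B) bs = val A bs + val B bs"
  by (induction n arbitrary: A B bs) (auto simp: full_Suc_iff full_0_iff length_Suc_conv)

fun all2 :: "(int \<Rightarrow> int \<Rightarrow> bool) \<Rightarrow> bit_tree \<Rightarrow> bit_tree \<Rightarrow> bool" where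
  "all2 P (Lf x) (Lf y) = P x y"
| "all2 P (Nd A B) (Nd C D) = (all2 P A C \<and> all2 P B D)"
| "all2 P _ _ = False"

lemma all2_val: "all2 P A B \<Longrightarrow> full n A \<Longrightarrow> length bs = n \<Longrightarrow> P (val A bs) (val B bs)"
proof (induction n arbitrary: A B bs)
  case (Suc n)
  then show ?case by (cases B) (auto simp: full_Suc_iff length_Suc_conv)
next
  case 0
  then show ?case by (cases B) (auto simp: full_0_iff)
qed

section \<open>Growth of strips\<close>

text \<open>The two end sites of a long column are the ones that lie in the boundary rows of the
  strip.\<close>

definition end_weight :: "bool list \<Rightarrow> int" where
  "end_weight t = (if hd t then 1 else 2) * (if last t then 1 else 2)"

text \<open>A tree of depth \<open>n\<close> tabulates a function on bit lists of length \<open>n\<close>. The zigzag sums are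
  computed for all index lists at once, branching on one bit at a time; the Boolean argument is the
  bit chosen last.\<close>

fun expand_from :: "bool \<Rightarrow> bit_tree \<Rightarrow> bit_tree" where
  "expand_from c (Lf x) = Lf (if c then x else 2 * x)"
| "expand_from c (Nd A B) = Nd (expand_from False (if c then A else add A B)) (expand_from True A)"

fun expand :: "bit_tree \<Rightarrow> bit_tree" where
  "expand T = Nd (expand_from False (add T T)) (expand_from True T)"

fun contract :: "bool \<Rightarrow> bit_tree \<Rightarrow> bit_tree" where
  "contract c (Nd (Lf a) (Lf b)) = Lf (if c then a else a + b)"
| "contract c (Nd A B) = Nd (contract False (if c then A else add A B)) (contract True A)"
| "contract c (Lf x) = Lf 0"

text \<open>The bit of \<open>s\<close> lying between the bit \<open>c\<close> and the next bit of
  \<open>ts\<close> may be set only if both are clear. In that case both halves of the table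
  contribute, as \<open>add A B\<close>; otherwise only \<open>A\<close> does. The leaf supplies the
  weight of the last bit.\<close>

lemma expand_from:
  "full n T \<Longrightarrow> full n (expand_from c T) \<and> (\<forall>ts. length ts = n \<longrightarrow>
     val (expand_from c T) ts
       = (\<Sum>s\<in>bitlists n. if zigzag s (c # ts) then (if last (c # ts) then 1 else 2) * val T s else 0))"
proof (induction n arbitrary: c T)
  case 0
  then show ?case by (auto simp: full_0_iff bitlists_0)
next
  case (Suc n)
  then obtain A B where T: "T = Nd A B" and A: "full n A" and B: "full n B" by (auto simp: full_Suc_iff)
  have AB: "full n (add A B)" by (rule full_add[OF A B])
  note IH = Suc.IH[OF A, of True] Suc.IH[OF A, of False] Suc.IH[OF AB, of False]
  show ?case
  proof (intro conjI allI impI)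
    show "full (Suc n) (expand_from c T)" using IH by (simp add: T)
    fix ts :: "bool list" assume "length ts = Suc n"
    then obtain t us where ts: "ts = t # us" "length us = n" by (auto simp: length_Suc_conv)
    have add: "val (add A B) s = val A s + val B s" if "s \<in> bitlists n" for s
      using val_add[OF A B] that by (simp add: bitlists_def)
    show "val (expand_from c T) ts
       = (\<Sum>s\<in>bitlists (Suc n). if zigzag s (c # ts) then (if last (c # ts) then 1 else 2) * val T s else 0)"
    proof (cases "c \<or> t")
      case True
      then show ?thesis using IH ts by (auto simp: T sum_bitlists_Suc cong: if_cong)
    next
      case False
      then have "val (expand_from c T) ts = (\<Sum>s\<in>bitlists n. if zigzag s (False # us)
          then (if last (False # us) then 1 else 2) * (val A s + val B s) else 0)"
        using IH ts add by (simp add: T cong: if_cong sum.cong)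
      also have "\<dots> = (\<Sum>s\<in>bitlists (Suc n). if zigzag s (c # ts) then (if last (c # ts) then 1 else 2) * val T s else 0)"
        using False ts by (auto simp: T sum_bitlists_Suc sum.distrib[symmetric] distrib_left intro!: sum.cong)
      finally show ?thesis .
    qed
  qed
qed

text \<open>Doubling the table in advance supplies the weight of a clear first bit.\<close>

lemma expand:
  assumes T: "full n T"
  shows "full (Suc n) (expand T)"
    and "length t = Suc n \<Longrightarrow>
      val (expand T) t = (\<Sum>s\<in>bitlists n. if zigzag s t then end_weight t * val T s else 0)"
proof -
  have TT: "full n (add T T)" by (rule full_add[OF T T])
  show "full (Suc n) (expand T)" using expand_from[OF T] expand_from[OF TT] by simp
  assume "length t = Suc n"
  then obtain c ts where t: "t = c # ts" "length ts = n" by (auto simp: length_Suc_conv)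
  have add: "val (add T T) s = 2 * val T s" if "s \<in> bitlists n" for s
    using val_add[OF T T] that by (simp add: bitlists_def)
  show "val (expand T) t = (\<Sum>s\<in>bitlists n. if zigzag s t then end_weight t * val T s else 0)"
    using expand_from[OF T, of True] expand_from[OF TT, of False] t
    by (cases c) (auto simp: end_weight_def add intro!: sum.cong)
qed

text \<open>The transposed sum: bits of \<open>t\<close> are summed out while those of
  \<open>s\<close> become indices. \<open>c\<close> is the preceding bit of \<open>s\<close>; if
  set, it forbids the first remaining bit of \<open>t\<close>.\<close>

lemma contract:
  "full (Suc n) T \<Longrightarrow> full n (contract c T) \<and> (\<forall>s. length s = n \<longrightarrow>
     val (contract c T) s
       = (\<Sum>t\<in>bitlists (Suc n). if (c \<longrightarrow> \<not> hd t) \<and> zigzag s t then val T t else 0))"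
proof (induction n arbitrary: c T)
  case 0
  then show ?case by (auto simp: full_Suc_iff full_0_iff bitlists_0 sum_bitlists_Suc)
next
  case (Suc n)
  then obtain A B where T: "T = Nd A B" and A: "full (Suc n) A" and B: "full (Suc n) B"
    by (auto simp: full_Suc_iff[of "Suc n"])
  have AB: "full (Suc n) (add A B)" by (rule full_add[OF A B])
  note IH = Suc.IH[OF A, of True] Suc.IH[OF A, of False] Suc.IH[OF AB, of False]
  have con: "contract c T = Nd (contract False (if c then A else add A B)) (contract True A)"
    using A by (auto simp: T full_Suc_iff)
  show ?case
  proof (intro conjI allI impI)
    show "full (Suc n) (contract c T)" using IH by (simp add: con)
    fix s :: "bool list" assume "length s = Suc n"
    then obtain b ss where s: "s = b # ss" "length ss = n" by (auto simp: length_Suc_conv)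
    have add: "val (add A B) t = val A t + val B t" if "t \<in> bitlists (Suc n)" for t
      using val_add[OF A B] that by (simp add: bitlists_def)
    have zz: "zigzag s (x # t) \<longleftrightarrow> (b \<longrightarrow> \<not> x \<and> \<not> hd t) \<and> zigzag ss t" if "t \<in> bitlists (Suc n)" for x t
      using that by (cases t) (auto simp: s bitlists_def)
    have "(\<Sum>t\<in>bitlists (Suc (Suc n)). if (c \<longrightarrow> \<not> hd t) \<and> zigzag s t then val T t else 0)
      = (\<Sum>t\<in>bitlists (Suc n). if (b \<longrightarrow> \<not> hd t) \<and> zigzag ss t
            then val A t + (if c \<or> b then 0 else val B t) else 0)"
      unfolding sum_bitlists_Suc[of _ "Suc n"] sum.distrib[symmetric] T
      by (rule sum.cong) (auto simp: zz)
    also have "\<dots> = val (contract c T) s"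
      unfolding con using IH s by (cases b; cases c) (auto simp: add intro!: sum.cong)
    finally show "val (contract c T) s
       = (\<Sum>t\<in>bitlists (Suc (Suc n)). if (c \<longrightarrow> \<not> hd t) \<and> zigzag s t then val T t else 0)" by simp
  qed
qed

definition strip_vec :: "nat \<Rightarrow> nat \<Rightarrow> bool list \<Rightarrow> real" where
  "strip_vec n = transfer_vec (\<lambda>k. bitlists (if even k then n else Suc n))
     (\<lambda>k p q. if even k then zigzag p q else zigzag q p) (\<lambda>k t. if even k then 1 else real_of_int (end_weight t))"

text \<open>Two columns at a time lead back to lists of length \<open>n\<close>, so that one table
  can be compared with its own image.\<close>

lemma strip_vec_Suc_Suc:
  "strip_vec n (2 * Suc k) s = (\<Sum>t\<in>bitlists (Suc n). if zigzag s t then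
     (\<Sum>r\<in>bitlists n. if zigzag r t then end_weight t * strip_vec n (2 * k) r else 0) else 0)"
  by (simp add: strip_vec_def sum.inter_filter[OF finite_bitlists] sum_distrib_left if_distrib cong: if_cong)

lemma val_strip_step:
  assumes "full n X" "length s = n"
  shows "real_of_int (val (contract False (expand X)) s) = (\<Sum>t\<in>bitlists (Suc n). if zigzag s t then
     (\<Sum>r\<in>bitlists n. if zigzag r t then end_weight t * real_of_int (val X r) else 0) else 0)"
proof -
  have "val (contract False (expand X)) s = (\<Sum>t\<in>bitlists (Suc n). if zigzag s t then
     (\<Sum>r\<in>bitlists n. if zigzag r t then end_weight t * val X r else 0) else 0)"
    using contract[OF expand(1)[OF assms(1)], of False] assms expand(2)[OF assms(1)]
    by (auto simp: bitlists_def simp del: expand.simps intro!: sum.cong)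
  then show ?thesis by (simp only: if_distrib of_int_sum of_int_mult of_int_0 cong: if_cong)
qed

lemma end_weight_nonneg: "0 \<le> end_weight t"
  by (simp add: end_weight_def)

text \<open>The rate is a fraction \<open>a / b\<close> so that the check is a comparison of
  integers. Entries of at least 1 make \<open>X\<close> dominate the initial vector of ones.\<close>

lemma strip_vec_le:
  assumes X: "full n X" and pos: "0 < b" "0 \<le> a" "all2 (\<lambda>x _. 1 \<le> x) X X"
    and check: "all2 (\<lambda>z x. b * z \<le> a * x) (contract False (expand X)) X"
  shows "length s = n \<Longrightarrow> strip_vec n (2 * k) s \<le> (a / b) ^ k * val X s"
proof (induction k arbitrary: s)
  case 0
  then show ?case using all2_val[OF pos(3) X, of s] by (simp add: strip_vec_def)
next
  case (Suc k)
  let ?r = "real_of_int a / real_of_int b"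
  have f: "full n (contract False (expand X))" using contract[OF expand(1)[OF X]] by blast
  have "b * val (contract False (expand X)) s \<le> a * val X s"
    by (rule all2_val[OF check f Suc.prems])
  then have "real_of_int b * real_of_int (val (contract False (expand X)) s) \<le> real_of_int a * val X s"
    by (metis of_int_le_iff of_int_mult)
  then have step: "real_of_int (val (contract False (expand X)) s) \<le> ?r * val X s"
    using pos(1) by (simp add: field_simps)
  have nn: "0 \<le> ?r" using pos by simp
  have IH: "strip_vec n (2 * k) r \<le> ?r ^ k * val X r" if "r \<in> bitlists n" for r
    using Suc.IH that by (simp add: bitlists_def)
  have "strip_vec n (2 * Suc k) s \<le> (\<Sum>t\<in>bitlists (Suc n). if zigzag s t then
     (\<Sum>r\<in>bitlists n. if zigzag r t then end_weight t * (?r ^ k * val X r) else 0) else 0)"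
    unfolding strip_vec_Suc_Suc
    by (intro sum_mono) (auto intro!: sum_mono mult_left_mono IH simp: end_weight_nonneg)
  also have "\<dots> = ?r ^ k * real_of_int (val (contract False (expand X)) s)"
    unfolding val_strip_step[OF X Suc.prems] by (simp add: sum_distrib_left if_distrib mult_ac cong: if_cong)
  also have "\<dots> \<le> ?r ^ k * (?r * val X s)"
    using step nn by (intro mult_left_mono) auto
  finally show ?case by (simp add: mult_ac)
qed

text \<open>Here \<open>X / M\<close> lies below the initial vector of ones, and the check keeps it
  below.\<close>

lemma strip_vec_ge:
  assumes X: "full n X" and pos: "0 < a" "0 < b" "all2 (\<lambda>x _. x \<le> M) X X"
    and check: "all2 (\<lambda>z x. a * x \<le> b * z) (contract False (expand X)) X"
  shows "length s = n \<Longrightarrow> (a / b) ^ k * val X s \<le> M * strip_vec n (2 * k) s"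
proof (induction k arbitrary: s)
  case 0
  then show ?case using all2_val[OF pos(3) X, of s] by (simp add: strip_vec_def)
next
  case (Suc k)
  let ?r = "real_of_int a / real_of_int b"
  have f: "full n (contract False (expand X))" using contract[OF expand(1)[OF X]] by blast
  have "a * val X s \<le> b * val (contract False (expand X)) s"
    by (rule all2_val[OF check f Suc.prems])
  then have "real_of_int a * val X s \<le> real_of_int b * real_of_int (val (contract False (expand X)) s)"
    by (metis of_int_le_iff of_int_mult)
  then have step: "?r * val X s \<le> real_of_int (val (contract False (expand X)) s)"
    using pos(2) by (simp add: field_simps)
  have IH: "?r ^ k * val X r \<le> M * strip_vec n (2 * k) r" if "r \<in> bitlists n" for r
    using Suc.IH that by (simp add: bitlists_def)
  have "?r ^ Suc k * val X s \<le> ?r ^ k * real_of_int (val (contract False (expand X)) s)"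
    using mult_left_mono[OF step, of "?r ^ k"] pos by (simp add: mult_ac del: expand.simps)
  also have "\<dots> = (\<Sum>t\<in>bitlists (Suc n). if zigzag s t then
     (\<Sum>r\<in>bitlists n. if zigzag r t then end_weight t * (?r ^ k * val X r) else 0) else 0)"
    unfolding val_strip_step[OF X Suc.prems] by (simp add: sum_distrib_left if_distrib mult_ac cong: if_cong)
  also have "\<dots> \<le> (\<Sum>t\<in>bitlists (Suc n). if zigzag s t then
     (\<Sum>r\<in>bitlists n. if zigzag r t then end_weight t * (M * strip_vec n (2 * k) r) else 0) else 0)"
    by (intro sum_mono) (auto intro!: sum_mono mult_left_mono IH simp: end_weight_nonneg)
  also have "\<dots> = M * strip_vec n (2 * Suc k) s"
    unfolding strip_vec_Suc_Suc by (simp add: sum_distrib_left if_distrib mult_ac cong: if_cong)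
  finally show ?case .
qed

section \<open>Growth of cylinders\<close>

text \<open>On the cylinder all columns have equal length; repeating the first entry of
  \<open>t\<close> closes the cycle.\<close>

definition zigzag_cyc :: "bool list \<Rightarrow> bool list \<Rightarrow> bool" where
  "zigzag_cyc s t \<longleftrightarrow> zigzag s (t @ [hd t])"

text \<open>Here \<open>c0\<close> is the first bit, which is needed again at the end to close the cycle.\<close>

fun cyc_check_from :: "int \<Rightarrow> int \<Rightarrow> bool \<Rightarrow> bool \<Rightarrow> bit_tree \<Rightarrow> bit_tree \<Rightarrow> bool" where
  "cyc_check_from a b c0 c (Nd (Lf u) (Lf v)) (Lf x) =
     (b * (if c then u else if c0 then u else u + v) \<le> a * x)"
| "cyc_check_from a b c0 c (Nd A B) (Nd X Y) =
     (cyc_check_from a b c0 False (if c then A else add A B) X \<and> cyc_check_from a b c0 True A Y)"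
| "cyc_check_from a b c0 c _ _ = False"

fun cyc_check :: "int \<Rightarrow> int \<Rightarrow> bit_tree \<Rightarrow> bool" where
  "cyc_check a b (Nd X Y) = (cyc_check_from a b False False (Nd X Y) X \<and> cyc_check_from a b True True (Nd X Y) Y)"
| "cyc_check a b (Lf x) = False"

text \<open>Both trees are descended together. \<open>T\<close> is one level deeper because a last
  bit of \<open>s\<close> sits between the last bit of the index list and \<open>c0\<close>; it may
  be set only if both are clear.\<close>

lemma cyc_check_from:
  "full (Suc n) T \<Longrightarrow> full n X \<Longrightarrow> cyc_check_from a b c0 c T X \<Longrightarrow> length ts = n \<Longrightarrow>
   b * (\<Sum>s\<in>bitlists (Suc n). if zigzag s (c # ts @ [c0]) then val T s else 0) \<le> a * val X ts"
proof (induction n arbitrary: c T X ts)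
  case 0
  then show ?case by (auto simp: full_Suc_iff full_0_iff bitlists_0 sum_bitlists_Suc split: if_splits)
next
  case (Suc n)
  then obtain A B where T: "T = Nd A B" and A: "full (Suc n) A" and B: "full (Suc n) B"
    by (auto simp: full_Suc_iff[of "Suc n"])
  obtain C D where X: "X = Nd C D" and C: "full n C" and D: "full n D"
    using Suc.prems(2) by (auto simp: full_Suc_iff)
  obtain t us where ts: "ts = t # us" "length us = n" using Suc.prems(4) by (auto simp: length_Suc_conv)
  have AB: "full (Suc n) (add A B)" by (rule full_add[OF A B])
  have chk: "cyc_check_from a b c0 False (if c then A else add A B) C" "cyc_check_from a b c0 True A D"
    using Suc.prems(3) A by (auto simp: T X full_Suc_iff)
  have add: "val (add A B) s = val A s + val B s" if "s \<in> bitlists (Suc n)" for s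
    using val_add[OF A B] that by (simp add: bitlists_def)
  have eq: "(\<Sum>s\<in>bitlists (Suc (Suc n)). if zigzag s (c # ts @ [c0]) then val T s else 0)
      = (\<Sum>s\<in>bitlists (Suc n). if zigzag s (t # us @ [c0]) then val (if c \<or> t then A else add A B) s else 0)"
    unfolding sum_bitlists_Suc[of _ "Suc n"] sum.distrib[symmetric] T ts
    by (rule sum.cong) (auto simp: add)
  show ?case
  proof (cases t)
    case True
    then show ?thesis using Suc.IH[OF A D chk(2) ts(2)] unfolding eq by (simp add: X ts(1) cong: if_cong)
  next
    case False
    have "full (Suc n) (if c then A else add A B)" using A AB by simp
    from Suc.IH[OF this C chk(1) ts(2)] show ?thesis using False unfolding eq by (simp add: X ts(1) cong: if_cong)
  qed
qed

lemma cyc_check: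
  assumes T: "full (Suc n) T" and check: "cyc_check a b T" and t: "length t = Suc n"
  shows "b * (\<Sum>s\<in>bitlists (Suc n). if zigzag_cyc s t then val T s else 0) \<le> a * val T t"
proof -
  obtain A B where AB: "T = Nd A B" "full n A" "full n B" using T by (auto simp: full_Suc_iff)
  obtain c ts where ts: "t = c # ts" "length ts = n" using t by (auto simp: length_Suc_conv)
  have "cyc_check_from a b c c T (if c then B else A)" using check by (cases c) (auto simp: AB)
  from cyc_check_from[OF T _ this ts(2)] AB show ?thesis
    by (simp add: zigzag_cyc_def ts split: if_splits)
qed

definition cyc_vec :: "nat \<Rightarrow> nat \<Rightarrow> bool list \<Rightarrow> real" where
  "cyc_vec n = transfer_vec (\<lambda>_. bitlists n) (\<lambda>_. zigzag_cyc) (\<lambda>_ _. 1)"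

lemma cyc_vec_le:
  assumes X: "full (Suc n) X" and pos: "0 < b" "0 \<le> a" "all2 (\<lambda>x _. 1 \<le> x) X X"
    and check: "cyc_check a b X"
  shows "length t = Suc n \<Longrightarrow> cyc_vec (Suc n) k t \<le> (a / b) ^ k * val X t"
proof (induction k arbitrary: t)
  case 0
  then show ?case using all2_val[OF pos(3) X, of t] by (simp add: cyc_vec_def)
next
  case (Suc k)
  let ?r = "real_of_int a / real_of_int b"
  let ?S = "\<Sum>s\<in>bitlists (Suc n). if zigzag_cyc s t then val X s else 0"
  have "real_of_int b * real_of_int ?S \<le> real_of_int a * val X t"
    using cyc_check[OF X check Suc.prems] by (metis of_int_le_iff of_int_mult)
  then have step: "real_of_int ?S \<le> ?r * val X t" using pos(1) by (simp add: field_simps)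
  have "cyc_vec (Suc n) (Suc k) t = (\<Sum>s\<in>bitlists (Suc n). if zigzag_cyc s t then cyc_vec (Suc n) k s else 0)"
    by (simp add: cyc_vec_def sum.inter_filter[OF finite_bitlists] cong: if_cong)
  also have "\<dots> \<le> (\<Sum>s\<in>bitlists (Suc n). if zigzag_cyc s t then ?r ^ k * val X s else 0)"
    by (intro sum_mono) (auto intro!: Suc.IH simp: bitlists_def)
  also have "\<dots> = ?r ^ k * real_of_int ?S"
    by (simp add: sum_distrib_left if_distrib cong: if_cong)
  also have "\<dots> \<le> ?r ^ k * (?r * val X t)" using step pos by (intro mult_left_mono) auto
  finally show ?case by (simp add: mult_ac)
qed

section \<open>Columns of the diamond\<close>

definition column_length :: "nat \<Rightarrow> nat \<Rightarrow> nat" where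
  "column_length n k = (if even k then n else Suc n)"

text \<open>Even columns have the heights 2, 4, ..., \<open>2 * n\<close>, odd ones the heights 1,
  3, ..., \<open>2 * n + 1\<close>. So exactly the odd columns meet the boundary rows.\<close>

definition column_point :: "nat \<Rightarrow> nat \<Rightarrow> int \<times> int" where
  "column_point k i = (int k + 1, 2 * int i + (if even k then 2 else 1))"

definition column_emb :: "nat \<Rightarrow> bool list \<Rightarrow> (int \<times> int) set" where
  "column_emb k bs = column_point k ` {i. i < length bs \<and> bs ! i}"

definition column_state :: "nat \<Rightarrow> nat \<Rightarrow> (int \<times> int) set \<Rightarrow> bool list" where
  "column_state n k S = map (\<lambda>i. column_point k i \<in> S) [0..<column_length n k]"

lemma column_point_eq_iff: "column_point k i = column_point k' i' \<longleftrightarrow> k = k' \<and> i = i'"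
  by (auto simp: column_point_def)

lemma column_adj:
  "aztec_adj (column_point k i) (column_point (Suc k) j) \<longleftrightarrow> (if even k then j = i \<or> j = Suc i else i = j \<or> i = Suc j)"
  "aztec_adj (column_point (Suc k) j) (column_point k i) \<longleftrightarrow> (if even k then j = i \<or> j = Suc i else i = j \<or> i = Suc j)"
  by (auto simp: aztec_adj_def column_point_def)

interpretation columns: layered_graph aztec_adj "\<lambda>k. column_point k ` {..<column_length n k}"
  "\<lambda>k. bitlists (column_length n k)" column_emb "column_state n"
  "\<lambda>k p q. if even k then zigzag p q else zigzag q p" for n
proof unfold_locales
  show "(if even k then zigzag p q else zigzag q p)
      = (\<forall>u\<in>column_emb k p. \<forall>v\<in>column_emb (Suc k) q. \<not> aztec_adj u v \<and> \<not> aztec_adj v u)"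
    if "p \<in> bitlists (column_length n k)" "q \<in> bitlists (column_length n (Suc k))" for k p q
  proof (cases "even k")
    case True
    then have len: "length q = Suc (length p)" using that by (simp add: bitlists_def column_length_def)
    have "(\<forall>u\<in>column_emb k p. \<forall>v\<in>column_emb (Suc k) q. \<not> aztec_adj u v \<and> \<not> aztec_adj v u)
      \<longleftrightarrow> (\<forall>i<length p. p ! i \<longrightarrow> \<not> q ! i \<and> \<not> q ! Suc i)"
    proof -
      have "(\<forall>u\<in>column_emb k p. \<forall>v\<in>column_emb (Suc k) q. \<not> aztec_adj u v \<and> \<not> aztec_adj v u)
        \<longleftrightarrow> (\<forall>i j. i < length p \<and> p ! i \<and> j < length q \<and> q ! j \<longrightarrow> \<not> (j = i \<or> j = Suc i))"
        using True by (simp add: column_emb_def column_adj) blast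
      also have "\<dots> \<longleftrightarrow> (\<forall>i<length p. p ! i \<longrightarrow> \<not> q ! i \<and> \<not> q ! Suc i)"
        unfolding len by (metis less_SucI not_less_eq)
      finally show ?thesis .
    qed
    then show ?thesis using True by (simp add: zigzag_iff len)
  next
    case False
    then have len: "length p = Suc (length q)" using that by (simp add: bitlists_def column_length_def)
    have "(\<forall>u\<in>column_emb k p. \<forall>v\<in>column_emb (Suc k) q. \<not> aztec_adj u v \<and> \<not> aztec_adj v u)
      \<longleftrightarrow> (\<forall>i<length q. q ! i \<longrightarrow> \<not> p ! i \<and> \<not> p ! Suc i)"
    proof -
      have "(\<forall>u\<in>column_emb k p. \<forall>v\<in>column_emb (Suc k) q. \<not> aztec_adj u v \<and> \<not> aztec_adj v u)
        \<longleftrightarrow> (\<forall>i j. i < length p \<and> p ! i \<and> j < length q \<and> q ! j \<longrightarrow> \<not> (i = j \<or> i = Suc j))"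
        using False by (simp add: column_emb_def column_adj) blast
      also have "\<dots> \<longleftrightarrow> (\<forall>i<length q. q ! i \<longrightarrow> \<not> p ! i \<and> \<not> p ! Suc i)"
        unfolding len by (metis less_SucI not_less_eq)
      finally show ?thesis .
    qed
    then show ?thesis using False by (simp add: zigzag_iff len)
  qed
  show "column_state n k (column_emb k q) = q" if "q \<in> bitlists (column_length n k)" for k q
    using that by (intro nth_equalityI)
      (auto simp: column_state_def column_emb_def bitlists_def column_point_eq_iff)
qed (auto simp: column_emb_def column_state_def bitlists_def column_point_eq_iff aztec_adj_def column_point_def)

lemma columns_upto: "columns.upto n (2 * m) = aztec_vertices m n"
proof (intro equalityI subsetI)
  fix v assume "v \<in> columns.upto n (2 * m)"
  then show "v \<in> aztec_vertices m n"
    unfolding columns.upto_def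
    by (auto simp: aztec_vertices_def column_point_def column_length_def split: if_splits; presburger)
next
  fix v assume v: "v \<in> aztec_vertices m n"
  obtain x y where xy: "v = (x, y)" by force
  define k i where "k = nat (x - 1)" and "i = nat ((y - (if even k then 2 else 1)) div 2)"
  have k: "k \<le> 2 * m" "x = int k + 1" using v by (auto simp: xy k_def aztec_vertices_def)
  have bds: "1 \<le> y" "y \<le> 2 * int n + 1" "even k \<longleftrightarrow> even y" using v by (auto simp: xy k(2) aztec_vertices_def)
  have i: "i < column_length n k \<and> y = 2 * int i + (if even k then 2 else 1)"
  proof (cases "even k")
    case True
    then obtain z where "y = 2 * z" using bds by (auto elim: evenE)
    then show ?thesis using True bds by (simp add: i_def column_length_def)
  next
    case False
    then obtain z where "y = 2 * z + 1" using bds by (auto elim: oddE)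
    then show ?thesis using False bds by (simp add: i_def column_length_def)
  qed
  then have "v = column_point k i" by (simp add: xy k column_point_def)
  then show "v \<in> columns.upto n (2 * m)" unfolding columns.upto_def using k i by blast
qed

text \<open>Activity \<open>1/2\<close> stands in for the missing neighbours of the boundary sites; with it, quotients of
  very short strips already approximate the entropy well.\<close>

definition boundary_weight :: "nat \<Rightarrow> int set \<Rightarrow> real" where
  "boundary_weight m s = (\<Prod>k\<le>2 * m. if odd k \<and> int k + 1 \<notin> s then 2 else 1)"

lemma boundary_weight_bounds: "1 \<le> boundary_weight m s" "boundary_weight m s \<le> 2 ^ Suc (2 * m)"
proof -
  show "1 \<le> boundary_weight m s" unfolding boundary_weight_def by (rule prod_ge_1) auto
  have "boundary_weight m s \<le> (\<Prod>k\<le>2 * m. 2)" unfolding boundary_weight_def by (rule prod_mono) auto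
  then show "boundary_weight m s \<le> 2 ^ Suc (2 * m)" by simp
qed

lemma strip_vec_column_length:
  "strip_vec n = transfer_vec (\<lambda>k. bitlists (column_length n k))
     (\<lambda>k p q. if even k then zigzag p q else zigzag q p) (\<lambda>k t. if even k then 1 else real_of_int (end_weight t))"
  unfolding strip_vec_def column_length_def ..

text \<open>The passage from rows to columns. Every odd column holds one site of each boundary row,
  at the head and at the end of its list, so the two row weights regroup into one
  \<open>end_weight\<close> per odd column.\<close>

lemma boundary_sum_eq_strip_vec:
  "boundary_sum m (boundary_weight m) n = (\<Sum>q\<in>bitlists n. strip_vec n (2 * m) q)"
proof -
  let ?w = "\<lambda>k t. if even k then 1 else real_of_int (end_weight t)"
  have "(if odd k \<and> int k + 1 \<notin> row_state m (2 * n) S then 2 else 1)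
      * (if odd k \<and> int k + 1 \<notin> row_state m 0 S then 2 else (1 :: real)) = ?w k (column_state n k S)"
    if "k \<le> 2 * m" for k S
  proof (cases "even k")
    case False
    then have "k < 2 * m" using that by (metis dvd_triv_left le_neq_implies_less)
    then have "int k + 1 \<in> row_sites m 0" "int k + 1 \<in> row_sites m (2 * n)"
      using False by (auto simp: row_sites_def)
    then have "int k + 1 \<in> row_state m 0 S \<longleftrightarrow> (int k + 1, 1) \<in> S"
      "int k + 1 \<in> row_state m (2 * n) S \<longleftrightarrow> (int k + 1, 2 * int n + 1) \<in> S"
      by (simp_all add: row_state_def)
    moreover have "hd (column_state n k S) \<longleftrightarrow> (int k + 1, 1) \<in> S"
      using False by (simp add: column_state_def column_length_def column_point_def hd_map upt_rec[of 0])
    moreover have "last (column_state n k S) \<longleftrightarrow> (int k + 1, 2 * int n + 1) \<in> S"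
      using False by (simp add: column_state_def column_length_def column_point_def)
    ultimately show ?thesis using False by (simp add: end_weight_def)
  qed simp
  then have "boundary_sum m (boundary_weight m) n
      = (\<Sum>S\<in>independent_sets (aztec_vertices m n) aztec_adj. 1 * (\<Prod>k\<le>2 * m. ?w k (column_state n k S)))"
    unfolding boundary_sum_def boundary_weight_def prod.distrib[symmetric]
    by (intro sum.cong refl) simp
  also have "\<dots> = (\<Sum>q\<in>bitlists n. strip_vec n (2 * m) q)"
    using columns.sum_independent_sets[where n = n and k = "2 * m" and g = "\<lambda>_. 1" and w = ?w,
      unfolded columns_upto, folded strip_vec_column_length] by (simp add: column_length_def)
  finally show ?thesis .
qed

section \<open>The cylinder\<close>

text \<open>Columns are indexed helically, so that all column steps look alike: for \<open>p = 10\<close> the vertex \<open>(k, i)\<close> is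
  the point of column \<open>k + 1\<close> at height \<open>2 * i - k + 2\<close> modulo 20.\<close>

definition cylinder_adj :: "nat \<Rightarrow> nat \<times> nat \<Rightarrow> nat \<times> nat \<Rightarrow> bool" where
  "cylinder_adj p = (\<lambda>(k, i) (k', i'). k' = Suc k \<and> (i' = i \<or> i' = Suc i mod p)
     \<or> k = Suc k' \<and> (i = i' \<or> i = Suc i' mod p))"

definition cylinder_count :: "nat \<Rightarrow> nat \<Rightarrow> nat" where
  "cylinder_count p k = card (independent_sets ({..k} \<times> {..<p}) (cylinder_adj p))"

lemma zigzag_cyc_iff:
  assumes "length s = Suc n" "length t = Suc n"
  shows "zigzag_cyc s t \<longleftrightarrow> (\<forall>i<Suc n. s ! i \<longrightarrow> \<not> t ! i \<and> \<not> t ! (Suc i mod Suc n))"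
proof -
  have "t \<noteq> []" using assms by auto
  then have "(t @ [hd t]) ! Suc i = t ! (Suc i mod Suc n)" if "i < Suc n" for i
    using that assms by (cases "i = n") (auto simp: nth_append hd_conv_nth)
  then show ?thesis using assms by (auto simp: zigzag_cyc_def zigzag_iff nth_append)
qed

text \<open>Writing the circumference as \<open>Suc n\<close> keeps the modulus positive and the
  lists nonempty.\<close>

interpretation cylinder: layered_graph "cylinder_adj (Suc n)" "\<lambda>k. {k} \<times> {..<Suc n}"
  "\<lambda>_. bitlists (Suc n)" "\<lambda>k bs. {k} \<times> {i. i < length bs \<and> bs ! i}"
  "\<lambda>k S. map (\<lambda>i. (k, i) \<in> S) [0..<Suc n]" "\<lambda>_. zigzag_cyc" for n
proof unfold_locales
  show "zigzag_cyc p q = (\<forall>u\<in>{k} \<times> {i. i < length p \<and> p ! i}. \<forall>v\<in>{Suc k} \<times> {i. i < length q \<and> q ! i}.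
      \<not> cylinder_adj (Suc n) u v \<and> \<not> cylinder_adj (Suc n) v u)"
    if "p \<in> bitlists (Suc n)" "q \<in> bitlists (Suc n)" for k p q
    using that mod_less_divisor[OF zero_less_Suc, of _ n]
    by (auto simp: bitlists_def zigzag_cyc_iff cylinder_adj_def simp del: mod_less_divisor)
  show "map (\<lambda>i. (k, i) \<in> {k} \<times> {i. i < length q \<and> q ! i}) [0..<Suc n] = q"
    if "q \<in> bitlists (Suc n)" for k q
    using that by (intro nth_equalityI) (auto simp: bitlists_def simp del: upt_Suc)
qed (auto simp: bitlists_def cylinder_adj_def simp del: upt_Suc)

lemma cylinder_count_eq: "real (cylinder_count (Suc n) k) = (\<Sum>q\<in>bitlists (Suc n). cyc_vec (Suc n) k q)"
proof -
  have "cylinder.upto n k = {..k} \<times> {..<Suc n}" unfolding cylinder.upto_def by auto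
  then show ?thesis
    using cylinder.sum_independent_sets[where n = n and k = k and g = "\<lambda>_. 1" and w = "\<lambda>_ _. 1"]
    by (simp add: cylinder_count_def cyc_vec_def)
qed

text \<open>The cylinder is obtained by gluing two copies of the diamond with eleven rows along their
  bottom rows and along their top rows; the second copy is turned upside down.\<close>

definition glue1 :: "int \<times> int \<Rightarrow> nat \<times> nat" where
  "glue1 = (\<lambda>(x, y). (nat (x - 1), nat ((x + y - 3) div 2 mod 10)))"

text \<open>Solving the height formula for \<open>i\<close> gives \<open>glue1\<close> for height
  \<open>y\<close> and \<open>glue2\<close> for height \<open>2 - y\<close>. This reflection modulo
  20 fixes 1 and 11, so the two end rows of the copies coincide.\<close>

definition glue2 :: "int \<times> int \<Rightarrow> nat \<times> nat" where
  "glue2 = (\<lambda>(x, y). (nat (x - 1), nat ((x - y - 1) div 2 mod 10)))"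

text \<open>Heights between 1 and 11 leave few multiples of 20 possible, so a congruence becomes a
  finite case split for linear arithmetic.\<close>

lemma dvd_20_cases:
  fixes d :: int
  assumes "20 dvd d"
  shows "d \<le> - 40 \<or> d = - 20 \<or> d = 0 \<or> d = 20 \<or> 40 \<le> d"
  using assms by (auto elim!: dvdE)

lemma half_mod_eq:
  fixes u v :: int
  assumes "even u" "even v"
  shows "nat (u div 2 mod 10) = nat (v div 2 mod 10) \<longleftrightarrow> 20 dvd u - v"
    and "nat (u div 2 mod 10) = Suc (nat (v div 2 mod 10)) mod 10 \<longleftrightarrow> 20 dvd u - v - 2"
proof -
  obtain a b where ab: "u = 2 * a" "v = 2 * b" using assms by (auto elim!: evenE)
  have dbl: "a mod 10 = c mod 10 \<longleftrightarrow> (2 * a - 2 * c) mod 20 = 0" for c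
    using mod_mult_mult1[of 2 "a - c" 10] by (simp add: mod_eq_dvd_iff mod_eq_0_iff_dvd right_diff_distrib)
  show "nat (u div 2 mod 10) = nat (v div 2 mod 10) \<longleftrightarrow> 20 dvd u - v"
    unfolding ab using dbl[of b] by (simp add: eq_nat_nat_iff mod_eq_0_iff_dvd)
  have "nat (a mod 10) = Suc (nat (b mod 10)) mod 10 \<longleftrightarrow> a mod 10 = (b mod 10 + 1) mod 10"
    by (simp add: nat_eq_iff zmod_int add.commute)
  then show "nat (u div 2 mod 10) = Suc (nat (v div 2 mod 10)) mod 10 \<longleftrightarrow> 20 dvd u - v - 2"
    unfolding ab using dbl[of "b + 1"] by (simp add: mod_simps diff_diff_eq mod_eq_0_iff_dvd)
qed

lemma cylinder_adj_Suc: "cylinder_adj p (k, i) (Suc k, i') \<longleftrightarrow> i' = i \<or> i' = Suc i mod p"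
  by (auto simp: cylinder_adj_def)

lemma cylinder_adj_fst: "cylinder_adj p g h \<Longrightarrow> fst h = Suc (fst g) \<or> fst g = Suc (fst h)"
  by (auto simp: cylinder_adj_def)

text \<open>Adjacent points of the cylinder have heights differing by 1 modulo 20. Within one copy
  heights differ by at most 10, so nothing wraps around. Across the copies \<open>y + y'\<close>
  must be 3 or 21, which puts one point into an end row and the other next to it.\<close>

lemma glue_adj_Suc:
  fixes x y y' :: int
  assumes "odd (x + y)" "even (x + y')" "1 \<le> y" "y \<le> 11" "1 \<le> y'" "y' \<le> 11" "1 \<le> x"
  defines "E \<equiv> cylinder_adj 10"
  shows "E (glue1 (x, y)) (glue1 (x + 1, y')) \<Longrightarrow> \<bar>y - y'\<bar> = 1"
    and "E (glue2 (x, y)) (glue2 (x + 1, y')) \<Longrightarrow> \<bar>y - y'\<bar> = 1"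
    and "E (glue1 (x, y)) (glue2 (x + 1, y')) \<Longrightarrow> \<bar>y - y'\<bar> = 1 \<and> (y \<in> {1, 11} \<or> y' \<in> {1, 11})"
    and "E (glue2 (x, y)) (glue1 (x + 1, y')) \<Longrightarrow> \<bar>y - y'\<bar> = 1 \<and> (y \<in> {1, 11} \<or> y' \<in> {1, 11})"
proof -
  have par: "even (x + y - 3)" "even (x - y - 1)" "even (x + 1 + y' - 3)" "even (x + 1 - y' - 1)"
    using assms(1,2) by presburger+
  have E: "E (nat (x - 1), i) (nat (x + 1 - 1), i') \<longleftrightarrow> i' = i \<or> i' = Suc i mod 10" for i i'
  proof -
    have "nat (x + 1 - 1) = Suc (nat (x - 1))" using assms(7) by simp
    then show ?thesis unfolding E_def by (simp only: cylinder_adj_Suc)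
  qed
  show "E (glue1 (x, y)) (glue1 (x + 1, y')) \<Longrightarrow> \<bar>y - y'\<bar> = 1"
    unfolding glue1_def prod.case E half_mod_eq[OF par(3,1)] using assms(3-6) by (auto dest!: dvd_20_cases; presburger)
  show "E (glue2 (x, y)) (glue2 (x + 1, y')) \<Longrightarrow> \<bar>y - y'\<bar> = 1"
    unfolding glue2_def prod.case E half_mod_eq[OF par(4,2)] using assms(3-6) by (auto dest!: dvd_20_cases; presburger)
  show "E (glue1 (x, y)) (glue2 (x + 1, y')) \<Longrightarrow> \<bar>y - y'\<bar> = 1 \<and> (y \<in> {1, 11} \<or> y' \<in> {1, 11})"
    unfolding glue1_def glue2_def prod.case E half_mod_eq[OF par(4,1)] insert_iff empty_iff
    using assms(3-6) by (auto dest!: dvd_20_cases; presburger)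
  show "E (glue2 (x, y)) (glue1 (x + 1, y')) \<Longrightarrow> \<bar>y - y'\<bar> = 1 \<and> (y \<in> {1, 11} \<or> y' \<in> {1, 11})"
    unfolding glue1_def glue2_def prod.case E half_mod_eq[OF par(3,2)] insert_iff empty_iff
    using assms(3-6) by (auto dest!: dvd_20_cases; presburger)
qed

lemma cylinder_adj_sym: "cylinder_adj p u v \<longleftrightarrow> cylinder_adj p v u"
  by (auto simp: cylinder_adj_def)

lemma mem_aztec_vertices_5:
  "(x, y) \<in> aztec_vertices m 5 \<longleftrightarrow> 1 \<le> x \<and> x \<le> 2 * int m + 1 \<and> 1 \<le> y \<and> y \<le> 11 \<and> odd (x + y)"
  by (auto simp: aztec_vertices_def)

lemma glue_adj:
  assumes u: "u \<in> aztec_vertices m 5" and v: "v \<in> aztec_vertices m 5"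
  shows "cylinder_adj 10 (glue1 u) (glue1 v) \<Longrightarrow> aztec_adj u v"
    and "cylinder_adj 10 (glue2 u) (glue2 v) \<Longrightarrow> aztec_adj u v"
    and "cylinder_adj 10 (glue1 u) (glue2 v) \<Longrightarrow> aztec_adj u v \<and> (snd u \<in> {1, 11} \<or> snd v \<in> {1, 11})"
proof -
  obtain x y x' y' where uv: "u = (x, y)" "v = (x', y')" by (metis surj_pair)
  note bds = u[unfolded uv mem_aztec_vertices_5] v[unfolded uv mem_aztec_vertices_5]
  have x: "x' = x + 1 \<or> x = x' + 1"
    if "cylinder_adj 10 g h" "fst g = nat (x - 1)" "fst h = nat (x' - 1)" for g h
    using cylinder_adj_fst[OF that(1)] bds unfolding that(2,3) by linarith
  have fst: "fst (glue1 u) = nat (x - 1)" "fst (glue2 u) = nat (x - 1)"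
    "fst (glue1 v) = nat (x' - 1)" "fst (glue2 v) = nat (x' - 1)"
    by (simp_all add: uv glue1_def glue2_def)
  have right: "odd (x + y)" "even (x + y')" if "x' = x + 1" using bds that by auto
  have left: "odd (x' + y')" "even (x' + y)" if "x = x' + 1" using bds that by auto
  show "aztec_adj u v" if E: "cylinder_adj 10 (glue1 u) (glue1 v)"
    using x[OF E fst(1,3)]
  proof (elim disjE)
    assume r: "x' = x + 1"
    then have "cylinder_adj 10 (glue1 (x, y)) (glue1 (x + 1, y'))" using E by (simp only: uv)
    then have "\<bar>y - y'\<bar> = 1" using glue_adj_Suc(1)[OF right[OF r]] bds by blast
    then show ?thesis by (simp add: uv aztec_adj_def r)
  next
    assume l: "x = x' + 1"
    then have "cylinder_adj 10 (glue1 (x', y')) (glue1 (x' + 1, y))"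
      using cylinder_adj_sym[THEN iffD1, OF E] by (simp only: uv)
    then have "\<bar>y' - y\<bar> = 1" using glue_adj_Suc(1)[OF left[OF l]] bds by blast
    then show ?thesis by (auto simp: uv aztec_adj_def l)
  qed
  show "aztec_adj u v" if E: "cylinder_adj 10 (glue2 u) (glue2 v)"
    using x[OF E fst(2,4)]
  proof (elim disjE)
    assume r: "x' = x + 1"
    then have "cylinder_adj 10 (glue2 (x, y)) (glue2 (x + 1, y'))" using E by (simp only: uv)
    then have "\<bar>y - y'\<bar> = 1" using glue_adj_Suc(2)[OF right[OF r]] bds by blast
    then show ?thesis by (simp add: uv aztec_adj_def r)
  next
    assume l: "x = x' + 1"
    then have "cylinder_adj 10 (glue2 (x', y')) (glue2 (x' + 1, y))"
      using cylinder_adj_sym[THEN iffD1, OF E] by (simp only: uv)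
    then have "\<bar>y' - y\<bar> = 1" using glue_adj_Suc(2)[OF left[OF l]] bds by blast
    then show ?thesis by (auto simp: uv aztec_adj_def l)
  qed
  show "aztec_adj u v \<and> (snd u \<in> {1, 11} \<or> snd v \<in> {1, 11})" if E: "cylinder_adj 10 (glue1 u) (glue2 v)"
    using x[OF E fst(1,4)]
  proof (elim disjE)
    assume r: "x' = x + 1"
    then have "cylinder_adj 10 (glue1 (x, y)) (glue2 (x + 1, y'))" using E by (simp only: uv)
    then have "\<bar>y - y'\<bar> = 1 \<and> (y \<in> {1, 11} \<or> y' \<in> {1, 11})" using glue_adj_Suc(3)[OF right[OF r]] bds by blast
    then show ?thesis by (simp add: uv aztec_adj_def r)
  next
    assume l: "x = x' + 1"
    then have "cylinder_adj 10 (glue2 (x', y')) (glue1 (x' + 1, y))"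
      using cylinder_adj_sym[THEN iffD1, OF E] by (simp only: uv)
    then have "\<bar>y' - y\<bar> = 1 \<and> (y' \<in> {1, 11} \<or> y \<in> {1, 11})" using glue_adj_Suc(4)[OF left[OF l]] bds by blast
    then show ?thesis by (auto simp: uv aztec_adj_def l)
  qed
qed

text \<open>If points of different copies coincide, then \<open>y + y'\<close> is 2 or 22, so both
  lie in the same end row.\<close>

lemma glue_inj:
  assumes u: "u \<in> aztec_vertices m 5" and v: "v \<in> aztec_vertices m 5"
  shows "glue1 u = glue1 v \<Longrightarrow> u = v"
    and "glue2 u = glue2 v \<Longrightarrow> u = v"
    and "glue1 u = glue2 v \<Longrightarrow> u = v \<and> snd u \<in> {1, 11}"
proof -
  obtain x y x' y' where uv: "u = (x, y)" "v = (x', y')" by (metis surj_pair)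
  note bds = u[unfolded uv mem_aztec_vertices_5] v[unfolded uv mem_aztec_vertices_5]
  have par: "even (x + y - 3)" "even (x' + y' - 3)" "even (x - y - 1)" "even (x' - y' - 1)"
    using bds by auto
  have x: "nat (x - 1) = nat (x' - 1) \<longleftrightarrow> x = x'" using bds by auto
  show "glue1 u = glue1 v \<Longrightarrow> u = v"
    unfolding uv glue1_def prod.case prod.inject x half_mod_eq(1)[OF par(1,2)] using bds by (auto dest!: dvd_20_cases)
  show "glue2 u = glue2 v \<Longrightarrow> u = v"
    unfolding uv glue2_def prod.case prod.inject x half_mod_eq(1)[OF par(3,4)] using bds by (auto dest!: dvd_20_cases)
  show "glue1 u = glue2 v \<Longrightarrow> u = v \<and> snd u \<in> {1, 11}"
    unfolding uv glue1_def glue2_def prod.case prod.inject x half_mod_eq(1)[OF par(1,4)] snd_conv insert_iff empty_iff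
    using bds by (auto dest!: dvd_20_cases)
qed

definition gluable :: "nat \<Rightarrow> ((int \<times> int) set \<times> (int \<times> int) set) set" where
  "gluable m = {(S, S'). S \<in> independent_sets (aztec_vertices m 5) aztec_adj
     \<and> S' \<in> independent_sets (aztec_vertices m 5) aztec_adj
     \<and> row_state m 0 S = row_state m 0 S' \<and> row_state m 10 S = row_state m 10 S'}"

lemma gluable_ends:
  assumes "(S, S') \<in> gluable m" "snd u \<in> {1, 11}"
  shows "u \<in> S \<longleftrightarrow> u \<in> S'"
proof -
  obtain x y where u: "u = (x, y)" by force
  have sub: "S \<subseteq> aztec_vertices m 5" "S' \<subseteq> aztec_vertices m 5"
    and eq: "row_state m 0 S = row_state m 0 S'" "row_state m 10 S = row_state m 10 S'"
    using assms(1) by (auto simp: gluable_def independent_sets_def)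
  have iff: "u \<in> T \<longleftrightarrow> x \<in> row_state m 0 T \<and> y = 1 \<or> x \<in> row_state m 10 T \<and> y = 11"
    if "T \<subseteq> aztec_vertices m 5" for T
  proof
    assume "u \<in> T"
    moreover from this have "(x, y) \<in> aztec_vertices m 5" using that u by blast
    ultimately show "x \<in> row_state m 0 T \<and> y = 1 \<or> x \<in> row_state m 10 T \<and> y = 11"
      using assms(2) by (auto simp: u row_state_def mem_aztec_vertices_5 row_sites_def)
  qed (auto simp: u row_state_def)
  show ?thesis unfolding iff[OF sub(1)] iff[OF sub(2)] eq ..
qed

text \<open>An injection suffices, since the cylinder count enters only as an upper bound.\<close>

lemma card_gluable_le: "card (gluable m) \<le> cylinder_count 10 (2 * m)"
  unfolding cylinder_count_def
proof (rule card_inj_on_le[where f = "\<lambda>(S, S'). glue1 ` S \<union> glue2 ` S'"])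
  let ?I = "independent_sets (aztec_vertices m 5) aztec_adj"
  show "finite (independent_sets ({..2 * m} \<times> {..<10}) (cylinder_adj 10))"
    by (rule finite_independent_sets) simp
  show "inj_on (\<lambda>(S, S'). glue1 ` S \<union> glue2 ` S') (gluable m)"
  proof (rule inj_onI, clarify)
    fix S S' T T'
    assume G: "(S, S') \<in> gluable m" "(T, T') \<in> gluable m"
      and eq: "glue1 ` S \<union> glue2 ` S' = glue1 ` T \<union> glue2 ` T'"
    \<comment> \<open>An inclusion of the glued sets already gives inclusions of both parts; points
      that coincide across the copies lie in the end rows, where the two members of a gluable pair
      agree.\<close>
    have main: "S \<subseteq> T \<and> S' \<subseteq> T'" if G: "(S, S') \<in> gluable m" "(T, T') \<in> gluable m"
      and le: "glue1 ` S \<union> glue2 ` S' \<subseteq> glue1 ` T \<union> glue2 ` T'" for S S' T T'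
    proof -
      have V: "S \<subseteq> aztec_vertices m 5" "S' \<subseteq> aztec_vertices m 5" "T \<subseteq> aztec_vertices m 5" "T' \<subseteq> aztec_vertices m 5"
        using G by (auto simp: gluable_def independent_sets_def)
      have "u \<in> T" if u: "u \<in> S" for u
      proof -
        have "glue1 u \<in> glue1 ` T \<union> glue2 ` T'" using le u by blast
        then show ?thesis
        proof (elim UnE imageE)
          fix v assume v: "glue1 u = glue2 v" "v \<in> T'"
          then have "u = v \<and> snd u \<in> {1, 11}" using glue_inj(3)[of u m v] V u by blast
          then show ?thesis using gluable_ends[OF G(2)] v by blast
        qed (use glue_inj(1)[of u m] V u in blast)
      qed
      moreover have "u \<in> T'" if u: "u \<in> S'" for u
      proof -
        have "glue2 u \<in> glue1 ` T \<union> glue2 ` T'" using le u by blast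
        then show ?thesis
        proof (elim UnE imageE)
          fix v assume v: "glue2 u = glue1 v" "v \<in> T"
          then have "v = u \<and> snd v \<in> {1, 11}" using glue_inj(3)[of v m u] V u by (metis subsetD)
          then show ?thesis using gluable_ends[OF G(2)] v by blast
        qed (use glue_inj(2)[of u m] V u in blast)
      qed
      ultimately show ?thesis by blast
    qed
    show "S = T \<and> S' = T'" using main[OF G] main[OF G(2,1)] eq by blast
  qed
  show "(\<lambda>(S, S'). glue1 ` S \<union> glue2 ` S') ` gluable m
      \<subseteq> independent_sets ({..2 * m} \<times> {..<10}) (cylinder_adj 10)"
  proof clarify
    fix S S' assume G: "(S, S') \<in> gluable m"
    then have V: "S \<subseteq> aztec_vertices m 5" "S' \<subseteq> aztec_vertices m 5"
      and ind: "\<And>u v. u \<in> S \<Longrightarrow> v \<in> S \<Longrightarrow> \<not> aztec_adj u v" "\<And>u v. u \<in> S' \<Longrightarrow> v \<in> S' \<Longrightarrow> \<not> aztec_adj u v"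
      by (auto simp: gluable_def independent_sets_def)
    have range: "glue1 u \<in> {..2 * m} \<times> {..<10} \<and> glue2 u \<in> {..2 * m} \<times> {..<10}" if "u \<in> aztec_vertices m 5" for u
      using that by (cases u) (auto simp: glue1_def glue2_def mem_aztec_vertices_5 nat_less_iff)
    have same: "\<not> cylinder_adj 10 (glue1 u) (glue1 v)" if "u \<in> S" "v \<in> S" for u v
      using glue_adj(1)[of u m v] that V ind by blast
    have same': "\<not> cylinder_adj 10 (glue2 u) (glue2 v)" if "u \<in> S'" "v \<in> S'" for u v
      using glue_adj(2)[of u m v] that V ind by blast
    \<comment> \<open>An edge between the copies has an endpoint in an end row. That endpoint
      belongs to both sets, so the edge would already violate independence inside one of
      them.\<close>
    have cross: "\<not> cylinder_adj 10 (glue1 u) (glue2 v)" if "u \<in> S" "v \<in> S'" for u v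
    proof
      assume "cylinder_adj 10 (glue1 u) (glue2 v)"
      then have "aztec_adj u v" "snd u \<in> {1, 11} \<or> snd v \<in> {1, 11}"
        using glue_adj(3)[of u m v] that V by blast+
      then show False using gluable_ends[OF G] ind that by blast
    qed
    have cross': "\<not> cylinder_adj 10 (glue2 v) (glue1 u)" if "u \<in> S" "v \<in> S'" for u v
      using cross[OF that] cylinder_adj_sym by blast
    have "glue1 ` S \<union> glue2 ` S' \<subseteq> {..2 * m} \<times> {..<10}" using range V by blast
    then show "glue1 ` S \<union> glue2 ` S' \<in> independent_sets ({..2 * m} \<times> {..<10}) (cylinder_adj 10)"
      unfolding independent_sets_def using same same' cross cross' by blast
  qed
qed

section \<open>The Frobenius norm of ten row steps\<close>

text \<open>\<open>N s c\<close> is an entry of the ten-row transfer matrix; its square counts pairs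
  of sets that share both end rows.\<close>

lemma sum_square_fibres:
  fixes m :: nat
  defines "I \<equiv> independent_sets (aztec_vertices m 5) aztec_adj"
    and "Q \<equiv> Pow (row_sites m 0)"
  defines "N \<equiv> \<lambda>s c. real (card {S \<in> I. row_state m 0 S = s \<and> row_state m 10 S = c})"
  shows "(\<Sum>c\<in>Q. \<Sum>s\<in>Q. (N s c)\<^sup>2) = real (card (gluable m))"
proof -
  have Q10: "row_sites m 10 = row_sites m 0" by (rule row_sites_parity) simp
  have finI: "finite I" unfolding I_def by (rule finite_independent_sets[OF finite_aztec_vertices])
  have finQ: "finite Q" unfolding Q_def by (simp add: finite_row_sites)
  have finG: "finite (gluable m)"
    by (rule finite_subset[of _ "I \<times> I"]) (auto simp: gluable_def I_def[symmetric] finI)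
  let ?st = "\<lambda>z. (row_state m 10 (fst z), row_state m 0 (fst z))"
  have fibre: "{z \<in> gluable m. row_state m 10 (fst z) = c \<and> row_state m 0 (fst z) = s}
      = {S \<in> I. row_state m 0 S = s \<and> row_state m 10 S = c} \<times> {S \<in> I. row_state m 0 S = s \<and> row_state m 10 S = c}" for c s
    by (auto simp: gluable_def I_def)
  have st_Q: "?st ` gluable m \<subseteq> Q \<times> Q"
    using Q10 by (auto simp: Q_def row_state_def)
  have "real (card (gluable m)) = (\<Sum>p\<in>Q \<times> Q. \<Sum>z | z \<in> gluable m \<and> ?st z = p. 1)"
    using sum.group[OF finG _ st_Q, of "\<lambda>_. 1 :: real"] finQ by simp
  also have "\<dots> = (\<Sum>(c, s)\<in>Q \<times> Q. (N s c)\<^sup>2)"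
    by (rule sum.cong) (auto simp: N_def fibre card_cartesian_product power2_eq_square)
  finally show ?thesis by (simp add: sum.cartesian_product)
qed

lemma row_vec_add: "even a \<Longrightarrow> row_vec m b (a + k) = row_vec m (row_vec m b a) k"
proof (induction k)
  case (Suc k)
  have "row_sites m (a + k) = row_sites m k" using Suc.prems by (intro row_sites_parity) simp
  then show ?case using Suc by (auto simp: fun_eq_iff)
qed (simp add: fun_eq_iff)

text \<open>Ten further rows act on row vectors as a matrix whose squared Frobenius norm counts the
  independent sets of the cylinder.\<close>

lemma aztec_count_step:
  "real (aztec_count m (10 * Suc k)) \<le> real (cylinder_count 10 (2 * m)) * real (aztec_count m (10 * k))"
proof -
  define I where "I = independent_sets (aztec_vertices m 5) aztec_adj"
  define Q where "Q = Pow (row_sites m 0)"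
  define N where "N s c = real (card {S \<in> I. row_state m 0 S = s \<and> row_state m 10 S = c})" for s c
  define v where "v = row_vec m (\<lambda>_. 1) (10 * k)"
  define v' where "v' = row_vec m (\<lambda>_. 1) (10 * Suc k)"
  have finI: "finite I" unfolding I_def by (rule finite_independent_sets[OF finite_aztec_vertices])
  have finQ: "finite Q" unfolding Q_def by (simp add: finite_row_sites)
  \<comment> \<open>Cut at its middle row, the diamond of order \<open>j\<close> gives the squared
    length of the vector after \<open>j\<close> rows. Hence ten more row steps of the vector raise
    the order by ten, that is, by twenty rows.\<close>
  have count: "real (aztec_count m j) = (\<Sum>q\<in>Q. (row_vec m (\<lambda>_. 1) j q)\<^sup>2)" if "even j" for j
  proof -
    have "row_sites m j = row_sites m 0" using that by (intro row_sites_parity) simp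
    then show ?thesis
      using row_inner_eq_boundary_sum[of j j m "\<lambda>_. 1"]
      by (simp add: boundary_sum_one row_inner_def Q_def power2_eq_square)
  qed
  have v': "v' c = (\<Sum>s\<in>Q. N s c * v s)" if c: "c \<in> Q" for c
  proof -
    have "row_sites m 10 = row_sites m 0" by (rule row_sites_parity) simp
    then have "row_vec m v 10 c = (\<Sum>S | S \<in> I \<and> row_state m 10 S = c. v (row_state m 0 S))"
      using row_vec_fibre[of c m 5 v] c by (simp add: I_def Q_def)
    also have "\<dots> = (\<Sum>s\<in>Q. \<Sum>S | S \<in> {S \<in> I. row_state m 10 S = c} \<and> row_state m 0 S = s. v (row_state m 0 S))"
      by (rule sum.group[symmetric]) (auto simp: finI finQ Q_def row_state_def finite_row_sites)
    also have "\<dots> = (\<Sum>s\<in>Q. N s c * v s)"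
    proof (rule sum.cong[OF refl])
      fix s
      have "{S \<in> {S \<in> I. row_state m 10 S = c}. row_state m 0 S = s} = {S \<in> I. row_state m 0 S = s \<and> row_state m 10 S = c}"
        by auto
      then show "(\<Sum>S | S \<in> {S \<in> I. row_state m 10 S = c} \<and> row_state m 0 S = s. v (row_state m 0 S)) = N s c * v s"
        by (simp add: N_def)
    qed
    moreover have "v' = row_vec m v 10"
      using row_vec_add[of "10 * k" m "\<lambda>_. 1" 10] by (simp add: v'_def v_def add.commute)
    ultimately show ?thesis by simp
  qed
  have "real (aztec_count m (10 * Suc k)) = (\<Sum>c\<in>Q. (v' c)\<^sup>2)" unfolding v'_def by (rule count) simp
  also have "\<dots> \<le> (\<Sum>c\<in>Q. (\<Sum>s\<in>Q. (N s c)\<^sup>2) * (\<Sum>s\<in>Q. (v s)\<^sup>2))"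
    by (intro sum_mono) (simp add: v' Cauchy_Schwarz_ineq_sum)
  also have "\<dots> = real (card (gluable m)) * real (aztec_count m (10 * k))"
    using sum_square_fibres[of m] count[of "10 * k"]
    by (simp add: sum_distrib_right[symmetric] I_def Q_def N_def v_def)
  also have "\<dots> \<le> real (cylinder_count 10 (2 * m)) * real (aztec_count m (10 * k))"
    using card_gluable_le[of m] by (intro mult_right_mono) auto
  finally show ?thesis .
qed

section \<open>Numerical certificates\<close>

text \<open>The tables below are rounded multiples of dominant eigenvectors. The constant
  \<open>3949203039 / 67108864\<close>, with denominator \<open>2 ^ 26\<close>, is \<open>1.503048372 ^ 10\<close> rounded down.\<close>

definition strip4_weights :: bit_tree where
  "strip4_weights =
    Nd (Nd (Nd (Nd (Lf 1218060) (Lf 582357)) (Nd (Lf 511860) (Lf 388516))) (Nd (Nd (Lf 511860) (Lf 263192))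
    (Nd (Lf 346400) (Lf 263192)))) (Nd (Nd (Nd (Lf 582357) (Lf 282449)) (Nd (Lf 263192) (Lf 200000))) (Nd
    (Nd (Lf 388516) (Lf 200000)) (Nd (Lf 263192) (Lf 200000))))"

definition strip5_weights :: bit_tree where
  "strip5_weights =
    Nd (Nd (Nd (Nd (Nd (Lf 1830628) (Lf 874444)) (Nd (Lf 766280) (Lf 581570))) (Nd (Nd (Lf 755850) (Lf
    388411)) (Nd (Lf 511249) (Lf 388411)))) (Nd (Nd (Nd (Lf 766280) (Lf 371658)) (Nd (Lf 346337) (Lf
    263183))) (Nd (Nd (Lf 511249) (Lf 263183)) (Nd (Lf 346337) (Lf 263183))))) (Nd (Nd (Nd (Nd (Lf 874444)
    (Lf 419081)) (Nd (Lf 371658) (Lf 282163))) (Nd (Nd (Lf 388411) (Lf 200000)) (Nd (Lf 263183) (Lf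
    200000)))) (Nd (Nd (Nd (Lf 581570) (Lf 282163)) (Nd (Lf 263183) (Lf 200000))) (Nd (Nd (Lf 388411) (Lf
    200000)) (Nd (Lf 263183) (Lf 200000)))))"

definition cylinder_weights :: bit_tree where
  "cylinder_weights =
    Nd (Nd (Nd (Nd (Nd (Nd (Nd (Nd (Nd (Nd (Lf 2353908433) (Lf 961751146)) (Nd (Lf 961751146) (Lf
    638525944))) (Nd (Nd (Lf 961751146) (Lf 424616412)) (Nd (Lf 638525944) (Lf 424616412)))) (Nd (Nd (Nd (Lf
    961751146) (Lf 399461073)) (Nd (Lf 424616412) (Lf 282484258))) (Nd (Nd (Lf 638525944) (Lf 282484258))
    (Nd (Lf 424616412) (Lf 282484258))))) (Nd (Nd (Nd (Nd (Lf 961751146) (Lf 394556359)) (Nd (Lf 399461073)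
    (Lf 265414432))) (Nd (Nd (Lf 424616412) (Lf 187974523)) (Nd (Lf 282484258) (Lf 187974523)))) (Nd (Nd (Nd
    (Lf 638525944) (Lf 265414432)) (Nd (Lf 282484258) (Lf 187974523))) (Nd (Nd (Lf 424616412) (Lf
    187974523)) (Nd (Lf 282484258) (Lf 187974523)))))) (Nd (Nd (Nd (Nd (Nd (Lf 961751146) (Lf 393708602))
    (Nd (Lf 394556359) (Lf 262193463))) (Nd (Nd (Lf 399461073) (Lf 176656747)) (Nd (Lf 265414432) (Lf
    176656747)))) (Nd (Nd (Nd (Lf 424616412) (Lf 176656747)) (Nd (Lf 187974523) (Lf 125161140))) (Nd (Nd (Lf
    282484258) (Lf 125161140)) (Nd (Lf 187974523) (Lf 125161140))))) (Nd (Nd (Nd (Nd (Lf 638525944) (Lf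
    262193463)) (Nd (Lf 265414432) (Lf 176458649))) (Nd (Nd (Lf 282484258) (Lf 125161140)) (Nd (Lf
    187974523) (Lf 125161140)))) (Nd (Nd (Nd (Lf 424616412) (Lf 176656747)) (Nd (Lf 187974523) (Lf
    125161140))) (Nd (Nd (Lf 282484258) (Lf 125161140)) (Nd (Lf 187974523) (Lf 125161140))))))) (Nd (Nd (Nd
    (Nd (Nd (Nd (Lf 961751146) (Lf 394556359)) (Nd (Lf 393708602) (Lf 262193463))) (Nd (Nd (Lf 394556359)
    (Lf 174890775)) (Nd (Lf 262193463) (Lf 174890775)))) (Nd (Nd (Nd (Lf 399461073) (Lf 166583743)) (Nd (Lf
    176656747) (Lf 117882575))) (Nd (Nd (Lf 265414432) (Lf 117882575)) (Nd (Lf 176656747) (Lf 117882575)))))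
    (Nd (Nd (Nd (Nd (Lf 424616412) (Lf 174890775)) (Nd (Lf 176656747) (Lf 117730089))) (Nd (Nd (Lf
    187974523) (Lf 83536583)) (Nd (Lf 125161140) (Lf 83536583)))) (Nd (Nd (Nd (Lf 282484258) (Lf 117882575))
    (Nd (Lf 125161140) (Lf 83536583))) (Nd (Nd (Lf 187974523) (Lf 83536583)) (Nd (Lf 125161140) (Lf
    83536583)))))) (Nd (Nd (Nd (Nd (Nd (Lf 638525944) (Lf 262193463)) (Nd (Lf 262193463) (Lf 174652869)))
    (Nd (Nd (Lf 265414432) (Lf 117730089)) (Nd (Lf 176458649) (Lf 117730089)))) (Nd (Nd (Nd (Lf 282484258)
    (Lf 117882575)) (Nd (Lf 125161140) (Lf 83536583))) (Nd (Nd (Lf 187974523) (Lf 83536583)) (Nd (Lf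
    125161140) (Lf 83536583))))) (Nd (Nd (Nd (Nd (Lf 424616412) (Lf 174890775)) (Nd (Lf 176656747) (Lf
    117730089))) (Nd (Nd (Lf 187974523) (Lf 83536583)) (Nd (Lf 125161140) (Lf 83536583)))) (Nd (Nd (Nd (Lf
    282484258) (Lf 117882575)) (Nd (Lf 125161140) (Lf 83536583))) (Nd (Nd (Lf 187974523) (Lf 83536583)) (Nd
    (Lf 125161140) (Lf 83536583)))))))) (Nd (Nd (Nd (Nd (Nd (Nd (Nd (Lf 961751146) (Lf 399461073)) (Nd (Lf
    394556359) (Lf 265414432))) (Nd (Nd (Lf 393708602) (Lf 176656747)) (Nd (Lf 262193463) (Lf 176656747))))
    (Nd (Nd (Nd (Lf 394556359) (Lf 166583743)) (Nd (Lf 174890775) (Lf 117882575))) (Nd (Nd (Lf 262193463)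
    (Lf 117882575)) (Nd (Lf 174890775) (Lf 117882575))))) (Nd (Nd (Nd (Nd (Lf 399461073) (Lf 166583743)) (Nd
    (Lf 166583743) (Lf 112140711))) (Nd (Nd (Lf 176656747) (Lf 79474150)) (Nd (Lf 117882575) (Lf
    79474150)))) (Nd (Nd (Nd (Lf 265414432) (Lf 112140711)) (Nd (Lf 117882575) (Lf 79474150))) (Nd (Nd (Lf
    176656747) (Lf 79474150)) (Nd (Lf 117882575) (Lf 79474150)))))) (Nd (Nd (Nd (Nd (Nd (Lf 424616412) (Lf
    176656747)) (Nd (Lf 174890775) (Lf 117730089))) (Nd (Nd (Lf 176656747) (Lf 79376398)) (Nd (Lf 117730089)
    (Lf 79376398)))) (Nd (Nd (Nd (Lf 187974523) (Lf 79474150)) (Nd (Lf 83536583) (Lf 56343051))) (Nd (Nd (Lf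
    125161140) (Lf 56343051)) (Nd (Lf 83536583) (Lf 56343051))))) (Nd (Nd (Nd (Nd (Lf 282484258) (Lf
    117882575)) (Nd (Lf 117882575) (Lf 79390804))) (Nd (Nd (Lf 125161140) (Lf 56343051)) (Nd (Lf 83536583)
    (Lf 56343051)))) (Nd (Nd (Nd (Lf 187974523) (Lf 79474150)) (Nd (Lf 83536583) (Lf 56343051))) (Nd (Nd (Lf
    125161140) (Lf 56343051)) (Nd (Lf 83536583) (Lf 56343051))))))) (Nd (Nd (Nd (Nd (Nd (Nd (Lf 638525944)
    (Lf 265414432)) (Nd (Lf 262193463) (Lf 176458649))) (Nd (Nd (Lf 262193463) (Lf 117730089)) (Nd (Lf
    174652869) (Lf 117730089)))) (Nd (Nd (Nd (Lf 265414432) (Lf 112140711)) (Nd (Lf 117730089) (Lf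
    79390804))) (Nd (Nd (Lf 176458649) (Lf 79390804)) (Nd (Lf 117730089) (Lf 79390804))))) (Nd (Nd (Nd (Nd
    (Lf 282484258) (Lf 117882575)) (Nd (Lf 117882575) (Lf 79390804))) (Nd (Nd (Lf 125161140) (Lf 56343051))
    (Nd (Lf 83536583) (Lf 56343051)))) (Nd (Nd (Nd (Lf 187974523) (Lf 79474150)) (Nd (Lf 83536583) (Lf
    56343051))) (Nd (Nd (Lf 125161140) (Lf 56343051)) (Nd (Lf 83536583) (Lf 56343051)))))) (Nd (Nd (Nd (Nd
    (Nd (Lf 424616412) (Lf 176656747)) (Nd (Lf 174890775) (Lf 117730089))) (Nd (Nd (Lf 176656747) (Lf
    79376398)) (Nd (Lf 117730089) (Lf 79376398)))) (Nd (Nd (Nd (Lf 187974523) (Lf 79474150)) (Nd (Lf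
    83536583) (Lf 56343051))) (Nd (Nd (Lf 125161140) (Lf 56343051)) (Nd (Lf 83536583) (Lf 56343051))))) (Nd
    (Nd (Nd (Nd (Lf 282484258) (Lf 117882575)) (Nd (Lf 117882575) (Lf 79390804))) (Nd (Nd (Lf 125161140) (Lf
    56343051)) (Nd (Lf 83536583) (Lf 56343051)))) (Nd (Nd (Nd (Lf 187974523) (Lf 79474150)) (Nd (Lf
    83536583) (Lf 56343051))) (Nd (Nd (Lf 125161140) (Lf 56343051)) (Nd (Lf 83536583) (Lf 56343051)))))))))
    (Nd (Nd (Nd (Nd (Nd (Nd (Nd (Nd (Lf 961751146) (Lf 424616412)) (Nd (Lf 399461073) (Lf 282484258))) (Nd
    (Nd (Lf 394556359) (Lf 187974523)) (Nd (Lf 265414432) (Lf 187974523)))) (Nd (Nd (Nd (Lf 393708602) (Lf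
    176656747)) (Nd (Lf 176656747) (Lf 125161140))) (Nd (Nd (Lf 262193463) (Lf 125161140)) (Nd (Lf
    176656747) (Lf 125161140))))) (Nd (Nd (Nd (Nd (Lf 394556359) (Lf 174890775)) (Nd (Lf 166583743) (Lf
    117882575))) (Nd (Nd (Lf 174890775) (Lf 83536583)) (Nd (Lf 117882575) (Lf 83536583)))) (Nd (Nd (Nd (Lf
    262193463) (Lf 117730089)) (Nd (Lf 117882575) (Lf 83536583))) (Nd (Nd (Lf 174890775) (Lf 83536583)) (Nd
    (Lf 117882575) (Lf 83536583)))))) (Nd (Nd (Nd (Nd (Nd (Lf 399461073) (Lf 176656747)) (Nd (Lf 166583743)
    (Lf 117882575))) (Nd (Nd (Lf 166583743) (Lf 79474150)) (Nd (Lf 112140711) (Lf 79474150)))) (Nd (Nd (Nd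
    (Lf 176656747) (Lf 79376398)) (Nd (Lf 79474150) (Lf 56343051))) (Nd (Nd (Lf 117882575) (Lf 56343051))
    (Nd (Lf 79474150) (Lf 56343051))))) (Nd (Nd (Nd (Nd (Lf 265414432) (Lf 117730089)) (Nd (Lf 112140711)
    (Lf 79390804))) (Nd (Nd (Lf 117882575) (Lf 56343051)) (Nd (Lf 79474150) (Lf 56343051)))) (Nd (Nd (Nd (Lf
    176656747) (Lf 79376398)) (Nd (Lf 79474150) (Lf 56343051))) (Nd (Nd (Lf 117882575) (Lf 56343051)) (Nd
    (Lf 79474150) (Lf 56343051))))))) (Nd (Nd (Nd (Nd (Nd (Nd (Lf 424616412) (Lf 187974523)) (Nd (Lf
    176656747) (Lf 125161140))) (Nd (Nd (Lf 174890775) (Lf 83536583)) (Nd (Lf 117730089) (Lf 83536583))))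
    (Nd (Nd (Nd (Lf 176656747) (Lf 79474150)) (Nd (Lf 79376398) (Lf 56343051))) (Nd (Nd (Lf 117730089) (Lf
    56343051)) (Nd (Lf 79376398) (Lf 56343051))))) (Nd (Nd (Nd (Nd (Lf 187974523) (Lf 83536583)) (Nd (Lf
    79474150) (Lf 56343051))) (Nd (Nd (Lf 83536583) (Lf 40000000)) (Nd (Lf 56343051) (Lf 40000000)))) (Nd
    (Nd (Nd (Lf 125161140) (Lf 56343051)) (Nd (Lf 56343051) (Lf 40000000))) (Nd (Nd (Lf 83536583) (Lf
    40000000)) (Nd (Lf 56343051) (Lf 40000000)))))) (Nd (Nd (Nd (Nd (Nd (Lf 282484258) (Lf 125161140)) (Nd
    (Lf 117882575) (Lf 83536583))) (Nd (Nd (Lf 117882575) (Lf 56343051)) (Nd (Lf 79390804) (Lf 56343051))))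
    (Nd (Nd (Nd (Lf 125161140) (Lf 56343051)) (Nd (Lf 56343051) (Lf 40000000))) (Nd (Nd (Lf 83536583) (Lf
    40000000)) (Nd (Lf 56343051) (Lf 40000000))))) (Nd (Nd (Nd (Nd (Lf 187974523) (Lf 83536583)) (Nd (Lf
    79474150) (Lf 56343051))) (Nd (Nd (Lf 83536583) (Lf 40000000)) (Nd (Lf 56343051) (Lf 40000000)))) (Nd
    (Nd (Nd (Lf 125161140) (Lf 56343051)) (Nd (Lf 56343051) (Lf 40000000))) (Nd (Nd (Lf 83536583) (Lf
    40000000)) (Nd (Lf 56343051) (Lf 40000000)))))))) (Nd (Nd (Nd (Nd (Nd (Nd (Nd (Lf 638525944) (Lf
    282484258)) (Nd (Lf 265414432) (Lf 187974523))) (Nd (Nd (Lf 262193463) (Lf 125161140)) (Nd (Lf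
    176458649) (Lf 125161140)))) (Nd (Nd (Nd (Lf 262193463) (Lf 117882575)) (Nd (Lf 117730089) (Lf
    83536583))) (Nd (Nd (Lf 174652869) (Lf 83536583)) (Nd (Lf 117730089) (Lf 83536583))))) (Nd (Nd (Nd (Nd
    (Lf 265414432) (Lf 117882575)) (Nd (Lf 112140711) (Lf 79474150))) (Nd (Nd (Lf 117730089) (Lf 56343051))
    (Nd (Lf 79390804) (Lf 56343051)))) (Nd (Nd (Nd (Lf 176458649) (Lf 79390804)) (Nd (Lf 79390804) (Lf
    56343051))) (Nd (Nd (Lf 117730089) (Lf 56343051)) (Nd (Lf 79390804) (Lf 56343051)))))) (Nd (Nd (Nd (Nd
    (Nd (Lf 282484258) (Lf 125161140)) (Nd (Lf 117882575) (Lf 83536583))) (Nd (Nd (Lf 117882575) (Lf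
    56343051)) (Nd (Lf 79390804) (Lf 56343051)))) (Nd (Nd (Nd (Lf 125161140) (Lf 56343051)) (Nd (Lf
    56343051) (Lf 40000000))) (Nd (Nd (Lf 83536583) (Lf 40000000)) (Nd (Lf 56343051) (Lf 40000000))))) (Nd
    (Nd (Nd (Nd (Lf 187974523) (Lf 83536583)) (Nd (Lf 79474150) (Lf 56343051))) (Nd (Nd (Lf 83536583) (Lf
    40000000)) (Nd (Lf 56343051) (Lf 40000000)))) (Nd (Nd (Nd (Lf 125161140) (Lf 56343051)) (Nd (Lf
    56343051) (Lf 40000000))) (Nd (Nd (Lf 83536583) (Lf 40000000)) (Nd (Lf 56343051) (Lf 40000000))))))) (Nd
    (Nd (Nd (Nd (Nd (Nd (Lf 424616412) (Lf 187974523)) (Nd (Lf 176656747) (Lf 125161140))) (Nd (Nd (Lf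
    174890775) (Lf 83536583)) (Nd (Lf 117730089) (Lf 83536583)))) (Nd (Nd (Nd (Lf 176656747) (Lf 79474150))
    (Nd (Lf 79376398) (Lf 56343051))) (Nd (Nd (Lf 117730089) (Lf 56343051)) (Nd (Lf 79376398) (Lf
    56343051))))) (Nd (Nd (Nd (Nd (Lf 187974523) (Lf 83536583)) (Nd (Lf 79474150) (Lf 56343051))) (Nd (Nd
    (Lf 83536583) (Lf 40000000)) (Nd (Lf 56343051) (Lf 40000000)))) (Nd (Nd (Nd (Lf 125161140) (Lf
    56343051)) (Nd (Lf 56343051) (Lf 40000000))) (Nd (Nd (Lf 83536583) (Lf 40000000)) (Nd (Lf 56343051) (Lf
    40000000)))))) (Nd (Nd (Nd (Nd (Nd (Lf 282484258) (Lf 125161140)) (Nd (Lf 117882575) (Lf 83536583))) (Nd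
    (Nd (Lf 117882575) (Lf 56343051)) (Nd (Lf 79390804) (Lf 56343051)))) (Nd (Nd (Nd (Lf 125161140) (Lf
    56343051)) (Nd (Lf 56343051) (Lf 40000000))) (Nd (Nd (Lf 83536583) (Lf 40000000)) (Nd (Lf 56343051) (Lf
    40000000))))) (Nd (Nd (Nd (Nd (Lf 187974523) (Lf 83536583)) (Nd (Lf 79474150) (Lf 56343051))) (Nd (Nd
    (Lf 83536583) (Lf 40000000)) (Nd (Lf 56343051) (Lf 40000000)))) (Nd (Nd (Nd (Lf 125161140) (Lf
    56343051)) (Nd (Lf 56343051) (Lf 40000000))) (Nd (Nd (Lf 83536583) (Lf 40000000)) (Nd (Lf 56343051) (Lf
    40000000)))))))))) (Nd (Nd (Nd (Nd (Nd (Nd (Nd (Nd (Nd (Lf 961751146) (Lf 638525944)) (Nd (Lf 424616412)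
    (Lf 424616412))) (Nd (Nd (Lf 399461073) (Lf 282484258)) (Nd (Lf 282484258) (Lf 282484258)))) (Nd (Nd (Nd
    (Lf 394556359) (Lf 265414432)) (Nd (Lf 187974523) (Lf 187974523))) (Nd (Nd (Lf 265414432) (Lf
    187974523)) (Nd (Lf 187974523) (Lf 187974523))))) (Nd (Nd (Nd (Nd (Lf 393708602) (Lf 262193463)) (Nd (Lf
    176656747) (Lf 176656747))) (Nd (Nd (Lf 176656747) (Lf 125161140)) (Nd (Lf 125161140) (Lf 125161140))))
    (Nd (Nd (Nd (Lf 262193463) (Lf 176458649)) (Nd (Lf 125161140) (Lf 125161140))) (Nd (Nd (Lf 176656747)
    (Lf 125161140)) (Nd (Lf 125161140) (Lf 125161140)))))) (Nd (Nd (Nd (Nd (Nd (Lf 394556359) (Lf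
    262193463)) (Nd (Lf 174890775) (Lf 174890775))) (Nd (Nd (Lf 166583743) (Lf 117882575)) (Nd (Lf
    117882575) (Lf 117882575)))) (Nd (Nd (Nd (Lf 174890775) (Lf 117730089)) (Nd (Lf 83536583) (Lf
    83536583))) (Nd (Nd (Lf 117882575) (Lf 83536583)) (Nd (Lf 83536583) (Lf 83536583))))) (Nd (Nd (Nd (Nd
    (Lf 262193463) (Lf 174652869)) (Nd (Lf 117730089) (Lf 117730089))) (Nd (Nd (Lf 117882575) (Lf 83536583))
    (Nd (Lf 83536583) (Lf 83536583)))) (Nd (Nd (Nd (Lf 174890775) (Lf 117730089)) (Nd (Lf 83536583) (Lf
    83536583))) (Nd (Nd (Lf 117882575) (Lf 83536583)) (Nd (Lf 83536583) (Lf 83536583))))))) (Nd (Nd (Nd (Nd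
    (Nd (Nd (Lf 399461073) (Lf 265414432)) (Nd (Lf 176656747) (Lf 176656747))) (Nd (Nd (Lf 166583743) (Lf
    117882575)) (Nd (Lf 117882575) (Lf 117882575)))) (Nd (Nd (Nd (Lf 166583743) (Lf 112140711)) (Nd (Lf
    79474150) (Lf 79474150))) (Nd (Nd (Lf 112140711) (Lf 79474150)) (Nd (Lf 79474150) (Lf 79474150))))) (Nd
    (Nd (Nd (Nd (Lf 176656747) (Lf 117730089)) (Nd (Lf 79376398) (Lf 79376398))) (Nd (Nd (Lf 79474150) (Lf
    56343051)) (Nd (Lf 56343051) (Lf 56343051)))) (Nd (Nd (Nd (Lf 117882575) (Lf 79390804)) (Nd (Lf
    56343051) (Lf 56343051))) (Nd (Nd (Lf 79474150) (Lf 56343051)) (Nd (Lf 56343051) (Lf 56343051)))))) (Nd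
    (Nd (Nd (Nd (Nd (Lf 265414432) (Lf 176458649)) (Nd (Lf 117730089) (Lf 117730089))) (Nd (Nd (Lf
    112140711) (Lf 79390804)) (Nd (Lf 79390804) (Lf 79390804)))) (Nd (Nd (Nd (Lf 117882575) (Lf 79390804))
    (Nd (Lf 56343051) (Lf 56343051))) (Nd (Nd (Lf 79474150) (Lf 56343051)) (Nd (Lf 56343051) (Lf
    56343051))))) (Nd (Nd (Nd (Nd (Lf 176656747) (Lf 117730089)) (Nd (Lf 79376398) (Lf 79376398))) (Nd (Nd
    (Lf 79474150) (Lf 56343051)) (Nd (Lf 56343051) (Lf 56343051)))) (Nd (Nd (Nd (Lf 117882575) (Lf
    79390804)) (Nd (Lf 56343051) (Lf 56343051))) (Nd (Nd (Lf 79474150) (Lf 56343051)) (Nd (Lf 56343051) (Lf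
    56343051)))))))) (Nd (Nd (Nd (Nd (Nd (Nd (Nd (Lf 424616412) (Lf 282484258)) (Nd (Lf 187974523) (Lf
    187974523))) (Nd (Nd (Lf 176656747) (Lf 125161140)) (Nd (Lf 125161140) (Lf 125161140)))) (Nd (Nd (Nd (Lf
    174890775) (Lf 117882575)) (Nd (Lf 83536583) (Lf 83536583))) (Nd (Nd (Lf 117730089) (Lf 83536583)) (Nd
    (Lf 83536583) (Lf 83536583))))) (Nd (Nd (Nd (Nd (Lf 176656747) (Lf 117882575)) (Nd (Lf 79474150) (Lf
    79474150))) (Nd (Nd (Lf 79376398) (Lf 56343051)) (Nd (Lf 56343051) (Lf 56343051)))) (Nd (Nd (Nd (Lf
    117730089) (Lf 79390804)) (Nd (Lf 56343051) (Lf 56343051))) (Nd (Nd (Lf 79376398) (Lf 56343051)) (Nd (Lf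
    56343051) (Lf 56343051)))))) (Nd (Nd (Nd (Nd (Nd (Lf 187974523) (Lf 125161140)) (Nd (Lf 83536583) (Lf
    83536583))) (Nd (Nd (Lf 79474150) (Lf 56343051)) (Nd (Lf 56343051) (Lf 56343051)))) (Nd (Nd (Nd (Lf
    83536583) (Lf 56343051)) (Nd (Lf 40000000) (Lf 40000000))) (Nd (Nd (Lf 56343051) (Lf 40000000)) (Nd (Lf
    40000000) (Lf 40000000))))) (Nd (Nd (Nd (Nd (Lf 125161140) (Lf 83536583)) (Nd (Lf 56343051) (Lf
    56343051))) (Nd (Nd (Lf 56343051) (Lf 40000000)) (Nd (Lf 40000000) (Lf 40000000)))) (Nd (Nd (Nd (Lf
    83536583) (Lf 56343051)) (Nd (Lf 40000000) (Lf 40000000))) (Nd (Nd (Lf 56343051) (Lf 40000000)) (Nd (Lf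
    40000000) (Lf 40000000))))))) (Nd (Nd (Nd (Nd (Nd (Nd (Lf 282484258) (Lf 187974523)) (Nd (Lf 125161140)
    (Lf 125161140))) (Nd (Nd (Lf 117882575) (Lf 83536583)) (Nd (Lf 83536583) (Lf 83536583)))) (Nd (Nd (Nd
    (Lf 117882575) (Lf 79474150)) (Nd (Lf 56343051) (Lf 56343051))) (Nd (Nd (Lf 79390804) (Lf 56343051)) (Nd
    (Lf 56343051) (Lf 56343051))))) (Nd (Nd (Nd (Nd (Lf 125161140) (Lf 83536583)) (Nd (Lf 56343051) (Lf
    56343051))) (Nd (Nd (Lf 56343051) (Lf 40000000)) (Nd (Lf 40000000) (Lf 40000000)))) (Nd (Nd (Nd (Lf
    83536583) (Lf 56343051)) (Nd (Lf 40000000) (Lf 40000000))) (Nd (Nd (Lf 56343051) (Lf 40000000)) (Nd (Lf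
    40000000) (Lf 40000000)))))) (Nd (Nd (Nd (Nd (Nd (Lf 187974523) (Lf 125161140)) (Nd (Lf 83536583) (Lf
    83536583))) (Nd (Nd (Lf 79474150) (Lf 56343051)) (Nd (Lf 56343051) (Lf 56343051)))) (Nd (Nd (Nd (Lf
    83536583) (Lf 56343051)) (Nd (Lf 40000000) (Lf 40000000))) (Nd (Nd (Lf 56343051) (Lf 40000000)) (Nd (Lf
    40000000) (Lf 40000000))))) (Nd (Nd (Nd (Nd (Lf 125161140) (Lf 83536583)) (Nd (Lf 56343051) (Lf
    56343051))) (Nd (Nd (Lf 56343051) (Lf 40000000)) (Nd (Lf 40000000) (Lf 40000000)))) (Nd (Nd (Nd (Lf
    83536583) (Lf 56343051)) (Nd (Lf 40000000) (Lf 40000000))) (Nd (Nd (Lf 56343051) (Lf 40000000)) (Nd (Lf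
    40000000) (Lf 40000000))))))))) (Nd (Nd (Nd (Nd (Nd (Nd (Nd (Nd (Lf 638525944) (Lf 424616412)) (Nd (Lf
    282484258) (Lf 282484258))) (Nd (Nd (Lf 265414432) (Lf 187974523)) (Nd (Lf 187974523) (Lf 187974523))))
    (Nd (Nd (Nd (Lf 262193463) (Lf 176656747)) (Nd (Lf 125161140) (Lf 125161140))) (Nd (Nd (Lf 176458649)
    (Lf 125161140)) (Nd (Lf 125161140) (Lf 125161140))))) (Nd (Nd (Nd (Nd (Lf 262193463) (Lf 174890775)) (Nd
    (Lf 117882575) (Lf 117882575))) (Nd (Nd (Lf 117730089) (Lf 83536583)) (Nd (Lf 83536583) (Lf 83536583))))
    (Nd (Nd (Nd (Lf 174652869) (Lf 117730089)) (Nd (Lf 83536583) (Lf 83536583))) (Nd (Nd (Lf 117730089) (Lf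
    83536583)) (Nd (Lf 83536583) (Lf 83536583)))))) (Nd (Nd (Nd (Nd (Nd (Lf 265414432) (Lf 176656747)) (Nd
    (Lf 117882575) (Lf 117882575))) (Nd (Nd (Lf 112140711) (Lf 79474150)) (Nd (Lf 79474150) (Lf 79474150))))
    (Nd (Nd (Nd (Lf 117730089) (Lf 79376398)) (Nd (Lf 56343051) (Lf 56343051))) (Nd (Nd (Lf 79390804) (Lf
    56343051)) (Nd (Lf 56343051) (Lf 56343051))))) (Nd (Nd (Nd (Nd (Lf 176458649) (Lf 117730089)) (Nd (Lf
    79390804) (Lf 79390804))) (Nd (Nd (Lf 79390804) (Lf 56343051)) (Nd (Lf 56343051) (Lf 56343051)))) (Nd
    (Nd (Nd (Lf 117730089) (Lf 79376398)) (Nd (Lf 56343051) (Lf 56343051))) (Nd (Nd (Lf 79390804) (Lf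
    56343051)) (Nd (Lf 56343051) (Lf 56343051))))))) (Nd (Nd (Nd (Nd (Nd (Nd (Lf 282484258) (Lf 187974523))
    (Nd (Lf 125161140) (Lf 125161140))) (Nd (Nd (Lf 117882575) (Lf 83536583)) (Nd (Lf 83536583) (Lf
    83536583)))) (Nd (Nd (Nd (Lf 117882575) (Lf 79474150)) (Nd (Lf 56343051) (Lf 56343051))) (Nd (Nd (Lf
    79390804) (Lf 56343051)) (Nd (Lf 56343051) (Lf 56343051))))) (Nd (Nd (Nd (Nd (Lf 125161140) (Lf
    83536583)) (Nd (Lf 56343051) (Lf 56343051))) (Nd (Nd (Lf 56343051) (Lf 40000000)) (Nd (Lf 40000000) (Lf
    40000000)))) (Nd (Nd (Nd (Lf 83536583) (Lf 56343051)) (Nd (Lf 40000000) (Lf 40000000))) (Nd (Nd (Lf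
    56343051) (Lf 40000000)) (Nd (Lf 40000000) (Lf 40000000)))))) (Nd (Nd (Nd (Nd (Nd (Lf 187974523) (Lf
    125161140)) (Nd (Lf 83536583) (Lf 83536583))) (Nd (Nd (Lf 79474150) (Lf 56343051)) (Nd (Lf 56343051) (Lf
    56343051)))) (Nd (Nd (Nd (Lf 83536583) (Lf 56343051)) (Nd (Lf 40000000) (Lf 40000000))) (Nd (Nd (Lf
    56343051) (Lf 40000000)) (Nd (Lf 40000000) (Lf 40000000))))) (Nd (Nd (Nd (Nd (Lf 125161140) (Lf
    83536583)) (Nd (Lf 56343051) (Lf 56343051))) (Nd (Nd (Lf 56343051) (Lf 40000000)) (Nd (Lf 40000000) (Lf
    40000000)))) (Nd (Nd (Nd (Lf 83536583) (Lf 56343051)) (Nd (Lf 40000000) (Lf 40000000))) (Nd (Nd (Lf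
    56343051) (Lf 40000000)) (Nd (Lf 40000000) (Lf 40000000)))))))) (Nd (Nd (Nd (Nd (Nd (Nd (Nd (Lf
    424616412) (Lf 282484258)) (Nd (Lf 187974523) (Lf 187974523))) (Nd (Nd (Lf 176656747) (Lf 125161140))
    (Nd (Lf 125161140) (Lf 125161140)))) (Nd (Nd (Nd (Lf 174890775) (Lf 117882575)) (Nd (Lf 83536583) (Lf
    83536583))) (Nd (Nd (Lf 117730089) (Lf 83536583)) (Nd (Lf 83536583) (Lf 83536583))))) (Nd (Nd (Nd (Nd
    (Lf 176656747) (Lf 117882575)) (Nd (Lf 79474150) (Lf 79474150))) (Nd (Nd (Lf 79376398) (Lf 56343051))
    (Nd (Lf 56343051) (Lf 56343051)))) (Nd (Nd (Nd (Lf 117730089) (Lf 79390804)) (Nd (Lf 56343051) (Lf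
    56343051))) (Nd (Nd (Lf 79376398) (Lf 56343051)) (Nd (Lf 56343051) (Lf 56343051)))))) (Nd (Nd (Nd (Nd
    (Nd (Lf 187974523) (Lf 125161140)) (Nd (Lf 83536583) (Lf 83536583))) (Nd (Nd (Lf 79474150) (Lf
    56343051)) (Nd (Lf 56343051) (Lf 56343051)))) (Nd (Nd (Nd (Lf 83536583) (Lf 56343051)) (Nd (Lf 40000000)
    (Lf 40000000))) (Nd (Nd (Lf 56343051) (Lf 40000000)) (Nd (Lf 40000000) (Lf 40000000))))) (Nd (Nd (Nd (Nd
    (Lf 125161140) (Lf 83536583)) (Nd (Lf 56343051) (Lf 56343051))) (Nd (Nd (Lf 56343051) (Lf 40000000)) (Nd
    (Lf 40000000) (Lf 40000000)))) (Nd (Nd (Nd (Lf 83536583) (Lf 56343051)) (Nd (Lf 40000000) (Lf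
    40000000))) (Nd (Nd (Lf 56343051) (Lf 40000000)) (Nd (Lf 40000000) (Lf 40000000))))))) (Nd (Nd (Nd (Nd
    (Nd (Nd (Lf 282484258) (Lf 187974523)) (Nd (Lf 125161140) (Lf 125161140))) (Nd (Nd (Lf 117882575) (Lf
    83536583)) (Nd (Lf 83536583) (Lf 83536583)))) (Nd (Nd (Nd (Lf 117882575) (Lf 79474150)) (Nd (Lf
    56343051) (Lf 56343051))) (Nd (Nd (Lf 79390804) (Lf 56343051)) (Nd (Lf 56343051) (Lf 56343051))))) (Nd
    (Nd (Nd (Nd (Lf 125161140) (Lf 83536583)) (Nd (Lf 56343051) (Lf 56343051))) (Nd (Nd (Lf 56343051) (Lf
    40000000)) (Nd (Lf 40000000) (Lf 40000000)))) (Nd (Nd (Nd (Lf 83536583) (Lf 56343051)) (Nd (Lf 40000000)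
    (Lf 40000000))) (Nd (Nd (Lf 56343051) (Lf 40000000)) (Nd (Lf 40000000) (Lf 40000000)))))) (Nd (Nd (Nd
    (Nd (Nd (Lf 187974523) (Lf 125161140)) (Nd (Lf 83536583) (Lf 83536583))) (Nd (Nd (Lf 79474150) (Lf
    56343051)) (Nd (Lf 56343051) (Lf 56343051)))) (Nd (Nd (Nd (Lf 83536583) (Lf 56343051)) (Nd (Lf 40000000)
    (Lf 40000000))) (Nd (Nd (Lf 56343051) (Lf 40000000)) (Nd (Lf 40000000) (Lf 40000000))))) (Nd (Nd (Nd (Nd
    (Lf 125161140) (Lf 83536583)) (Nd (Lf 56343051) (Lf 56343051))) (Nd (Nd (Lf 56343051) (Lf 40000000)) (Nd
    (Lf 40000000) (Lf 40000000)))) (Nd (Nd (Nd (Lf 83536583) (Lf 56343051)) (Nd (Lf 40000000) (Lf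
    40000000))) (Nd (Nd (Lf 56343051) (Lf 40000000)) (Nd (Lf 40000000) (Lf 40000000))))))))))"

text \<open>The strip of height 4 stands in the denominator of the quotient, so its rate 129.302970
  is certified from above.\<close>

lemma strip4_weights:
  "full 4 strip4_weights" "all2 (\<lambda>x _. 1 \<le> x) strip4_weights strip4_weights"
  "all2 (\<lambda>z x. 1000000 * z \<le> 129302970 * x) (contract False (expand strip4_weights)) strip4_weights"
  by code_simp+

text \<open>The numerator is certified from below, with rate 292.113540. The number 1830628 is the
  largest table entry and plays the role of \<open>M\<close> in \<open>strip_vec_ge\<close>.\<close>

lemma strip5_weights:
  "full 5 strip5_weights" "all2 (\<lambda>x _. 1 \<le> x) strip5_weights strip5_weights"
  "all2 (\<lambda>x _. x \<le> 1830628) strip5_weights strip5_weights"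
  "all2 (\<lambda>z x. 292113540 * x \<le> 1000000 * z) (contract False (expand strip5_weights)) strip5_weights"
  by code_simp+

lemma cylinder_weights:
  "full 10 cylinder_weights" "all2 (\<lambda>x _. 1 \<le> x) cylinder_weights cylinder_weights"
  "cyc_check 3949203039 67108864 cylinder_weights"
  by code_simp+

section \<open>From the certificates to the growth rates\<close>

lemma val_bounds:
  assumes "full n X" "all2 (\<lambda>x _. 1 \<le> x) X X" "s \<in> bitlists n"
  shows "1 \<le> val X s"
  using all2_val[OF assms(2,1)] assms(3) by (simp add: bitlists_def)

lemma sum_val_pos:
  assumes "full n X" "all2 (\<lambda>x _. 1 \<le> x) X X"
  shows "0 < (\<Sum>s\<in>bitlists n. real_of_int (val X s))"
proof (rule sum_pos)
  show "bitlists n \<noteq> {}" using length_replicate[of n True] unfolding bitlists_def by blast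
  show "0 < real_of_int (val X s)" if "s \<in> bitlists n" for s
    using val_bounds[OF assms that] by simp
qed (rule finite_bitlists)

lemma sum_strip_vec_le:
  assumes "full n X" "0 < b" "0 \<le> a" "all2 (\<lambda>x _. 1 \<le> x) X X"
    and "all2 (\<lambda>z x. b * z \<le> a * x) (contract False (expand X)) X"
  shows "(\<Sum>s\<in>bitlists n. strip_vec n (2 * k) s)
    \<le> (\<Sum>s\<in>bitlists n. real_of_int (val X s)) * (a / b) ^ k"
  unfolding sum_distrib_right
  by (rule sum_mono) (use strip_vec_le[OF assms] in \<open>simp add: bitlists_def mult.commute\<close>)

lemma sum_strip_vec_ge:
  assumes "full n X" "0 < a" "0 < b" "all2 (\<lambda>x _. x \<le> M) X X"
    and "all2 (\<lambda>z x. a * x \<le> b * z) (contract False (expand X)) X" and M: "0 < M"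
  shows "(\<Sum>s\<in>bitlists n. real_of_int (val X s)) / M * (a / b) ^ k
    \<le> (\<Sum>s\<in>bitlists n. strip_vec n (2 * k) s)"
proof -
  have "(a / b) ^ k * (\<Sum>s\<in>bitlists n. real_of_int (val X s))
      \<le> M * (\<Sum>s\<in>bitlists n. strip_vec n (2 * k) s)"
    unfolding sum_distrib_left
    by (rule sum_mono) (use strip_vec_ge[OF assms(1-5)] in \<open>simp add: bitlists_def\<close>)
  then have "(a / b) ^ k * (\<Sum>s\<in>bitlists n. real_of_int (val X s)) / M
      \<le> (\<Sum>s\<in>bitlists n. strip_vec n (2 * k) s)"
    using M by (simp only: pos_divide_le_eq of_int_0_less_iff mult.commute)
  then show ?thesis by (simp only: times_divide_eq_left mult.commute[of "(a / b) ^ k"])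
qed

lemma sum_cyc_vec_le:
  assumes "full (Suc n) X" "0 < b" "0 \<le> a" "all2 (\<lambda>x _. 1 \<le> x) X X" "cyc_check a b X"
  shows "(\<Sum>t\<in>bitlists (Suc n). cyc_vec (Suc n) k t)
    \<le> (\<Sum>t\<in>bitlists (Suc n). real_of_int (val X t)) * (a / b) ^ k"
  unfolding sum_distrib_right
  by (rule sum_mono) (use cyc_vec_le[OF assms] in \<open>simp add: bitlists_def mult.commute\<close>)

lemma boundary_sum_4_le:
  "boundary_sum m (boundary_weight m) 4
    \<le> (\<Sum>s\<in>bitlists 4. real_of_int (val strip4_weights s)) * (129302970 / 1000000) ^ m"
  using sum_strip_vec_le[OF strip4_weights(1) _ _ strip4_weights(2,3), of m]
  by (simp only: boundary_sum_eq_strip_vec of_int_numeral)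

lemma boundary_sum_5_ge:
  "(\<Sum>s\<in>bitlists 5. real_of_int (val strip5_weights s)) / 1830628 * (292113540 / 1000000) ^ m
    \<le> boundary_sum m (boundary_weight m) 5"
  using sum_strip_vec_ge[OF strip5_weights(1) _ _ strip5_weights(3,4), of m]
  by (simp only: boundary_sum_eq_strip_vec of_int_numeral)

text \<open>Columns \<open>0\<close> to \<open>2 * m\<close> involve \<open>2 * m\<close> steps, so
  the rate per unit of \<open>m\<close> is the square of the certified one.\<close>

lemma cylinder_count_le:
  "real (cylinder_count 10 (2 * m))
    \<le> (\<Sum>t\<in>bitlists 10. real_of_int (val cylinder_weights t)) * ((3949203039 / 67108864)\<^sup>2) ^ m"
  using sum_cyc_vec_le[of 9 cylinder_weights 67108864 3949203039 "2 * m"] cylinder_weights cylinder_count_eq[of 9 "2 * m"]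
  by (simp add: power_mult[of _ 2 m])

theorem mainTheorem5:
  shows "\<exists>\<eta>::real.
    ((\<lambda>(m, n). real (aztec_count m n) powr (1 / real (2 * m * n + m + n))) \<longlongrightarrow> \<eta>)
      (sequentially \<times>\<^sub>F sequentially) \<and>
    1.503041110 \<le> \<eta> \<and> \<eta> \<le> 1.503048372"
proof -
  obtain L where L: "\<And>m n. real (aztec_count m n) \<le> exp (L * ((real m + 1) * (real n + 1)))"
    and lim: "((\<lambda>(m, n). ln (real (aztec_count m n)) / ((real m + 1) * (real n + 1))) \<longlongrightarrow> L)
      (sequentially \<times>\<^sub>F sequentially)"
    by (rule aztec_entropy) blast
  \<comment> \<open>The weights are bounded by \<open>2 ^ (2 * m + 1)\<close>, one factor 2 for each
    of the \<open>2 * m + 1\<close> indices in their product.\<close>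
  have "292113540 / 1000000 \<le> 129302970 / 1000000 * exp L"
  proof (rule entropy_lower_bound[OF L, of boundary_weight "\<lambda>m. 2 ^ Suc (2 * m)" _ _ 4])
    show "0 < (\<Sum>s\<in>bitlists 5. real_of_int (val strip5_weights s)) / 1830628"
      using sum_val_pos[OF strip5_weights(1,2)] by simp
  qed (use boundary_weight_bounds boundary_sum_4_le boundary_sum_5_ge in auto)
  then have "(1.503041110 :: real)\<^sup>2 \<le> exp L" by (simp add: power2_eq_square)
  also have "exp L = (exp (L / 2))\<^sup>2" by (simp add: exp_double[symmetric])
  finally have "(1.503041110 :: real)\<^sup>2 \<le> (exp (L / 2))\<^sup>2" .
  then have lower: "1.503041110 \<le> exp (L / 2)" by (rule power2_le_imp_le) simp
  \<comment> \<open>Since \<open>exp L\<close> is the square of \<open>exp (L / 2)\<close>, a step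
    of ten in \<open>n\<close> produces the twentieth power of the entropy constant.\<close>
  have "exp (L * real 10) \<le> (3949203039 / 67108864)\<^sup>2"
    by (rule entropy_upper_bound[OF lim aztec_count_step _ cylinder_count_le])
      (use sum_val_pos[OF cylinder_weights(1,2)] in auto)
  also have "\<dots> \<le> ((1.503048372 :: real) ^ 10)\<^sup>2" by (rule power_mono) (simp_all add: power_divide)
  also have "\<dots> = 1.503048372 ^ 20" by (simp only: power_mult[symmetric]) simp
  also have "exp (L * real 10) = exp (L / 2) ^ 20" by (simp add: exp_of_nat_mult[symmetric])
  finally have "exp (L / 2) ^ Suc 19 \<le> 1.503048372 ^ Suc 19" by simp
  then have upper: "exp (L / 2) \<le> 1.503048372" by (rule power_le_imp_le_base) simp
  show ?thesis using aztec_root_limit[OF lim] lower upper by blast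
qed

end
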